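(* Let $k,n\ge3$ and $g\ge0$. Let $\rho_{k,n}:B_{k,n}(\widehat\Sigma_g)\to B_{k,n}(\widehat\Sigma_g)/\Gamma_3(B_{k,n}(\widehat\Sigma_g))$ be the canonical projection. The group $B_{k,n}(\widehat\Sigma_g)/\Gamma_3(B_{k,n}(\widehat\Sigma_g))$ admits the following presentation. Generating set: $\Omega=\rho_{k,n}(S\cup\widetilde S\cup AB\cup\widetilde{AB}\cup Z)=\{\sigma,\tilde\sigma,\zeta\}\cup AB\cup\widetilde{AB}$ (elements of $AB\cup\widetilde{AB}$ keeping their names). Relations: (a) $xy=yx$ for all $x,y\in\Omega$ with $x\ne y$ and $\{x,y\}\notin\{\{a_i,b_i\},\{\tilde a_i,\tilde b_i\},\{b_i,\tilde a_i\},\{\tilde b_i,a_i\}: i=1,\dots,g\}$; (b) $[a_i,b_i]=\sigma^2$, $[\tilde a_i,\tilde b_i]=\tilde\sigma^2$ and $[a_i,\tilde b_i]=[\tilde a_i,b_i]=\zeta$ for all $i=1,\dots,g$. In particular, $\rho_{k,n}(S)=\{\sigma\}$, $\rho_{k,n}(\widetilde S)=\{\tilde\sigma\}$ and $\rho_{k,n}(Z)=\{\zeta\}$.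
   Context: If $g=0$ the sets $AB,\widetilde{AB}$ are empty and relations involving their elements are suppressed. For a connected surface $\Sigma$, $B_{k,n}(\Sigma)=\pi_1(\mathbb F_{k+n}(\Sigma)/(S_k\times S_n))$, where $\mathbb F_m(\Sigma)=\{(x_1,\dots,x_m)\in\Sigma^m: x_i\neq x_j\ (i\ne j)\}$. $\widehat\Sigma_g$ is a compact connected orientable surface of genus $g$ with one boundary component. $\Gamma_1(G)=G$, $\Gamma_i(G)=[G,\Gamma_{i-1}(G)]$; $[x,y]=xyx^{-1}y^{-1}$, $x^y=y^{-1}xy$. Presentation of $B_{k,n}(\widehat\Sigma_g)$. Generators: $S=\{\sigma_1,\dots,\sigma_{k-1}\}$, $\widetilde S=\{\tilde\sigma_1,\dots,\tilde\sigma_{n-1}\}$, $AB=\{a_1,b_1,\dots,a_g,b_g\}$, $\widetilde{AB}=\{\tilde a_1,\tilde b_1,\dots,\tilde a_g,\tilde b_g\}$, $Z=\{\zeta_1,\dots,\zeta_n\}$. Write $c<d$ for $c\in\{a_i,b_i\}$, $d\in\{a_j,b_j\}$, $i<j$. Relations (for all indices for which they make sense): (a) $\sigma_i\sigma_j=\sigma_j\sigma_i$ for $|i-j|\ge2$; $\sigma_i\sigma_{i+1}\sigma_i=\sigma_{i+1}\sigma_i\sigma_{i+1}$; $c\sigma_i=\sigma_ic$ for $i\neq1$, $c\in AB\cup Z$; $c\sigma_1c\sigma_1=\sigma_1c\sigma_1c$ for $c\in AB\cup Z$; $a_i\sigma_1b_i=\sigma_1b_i\sigma_1a_i\sigma_1$;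 $\sigma_1^{-1}c\sigma_1$ commutes with $d$ for $c,d\in AB$, $c<d$; $\sigma_1^{-1}\zeta_i\sigma_1$ commutes with every $c\in AB$, and with $\zeta_j$ for $i<j$. (b) The relations of (a) among $S\cup AB$ only, with $k$ replaced by $n$ and $\sigma_i,a_i,b_i$ by $\tilde\sigma_i,\tilde a_i,\tilde b_i$. (c) $\tilde\sigma_i,\tilde a_i,\tilde b_i$ commute with every $\sigma_j$; $\tilde\sigma_i$ commutes with $a_j,b_j$; $\tilde\sigma_i\zeta_{i+1}\tilde\sigma_i^{-1}=\zeta_i$; $\tilde\sigma_i\zeta_i\tilde\sigma_i^{-1}=\zeta_i^{-1}\zeta_{i+1}\zeta_i$; $\tilde\sigma_i\zeta_j\tilde\sigma_i^{-1}=\zeta_j$ for $j\ne i,i+1$; for $(\tilde x,x)=(\tilde a_i,a_i)$ or $(\tilde b_i,b_i)$: $\tilde x\zeta_1\tilde x^{-1}=\zeta_1^{x\zeta_1}$, $\tilde x\zeta_j\tilde x^{-1}=\zeta_j^{[x^{-1},\zeta_1^{-1}]}$ for $j\ne1$, $\tilde xx\tilde x^{-1}=\zeta_1^{-1}x\zeta_1$, and for $d\in\{a_j,b_j\}$, $\tilde xd\tilde x^{-1}=d^{[x^{-1},\zeta_1^{-1}]}$ if $i>j$, $\tilde xd\tilde x^{-1}=d$ if $j>i$; $\tilde a_ib_i\tilde a_i^{-1}=b_i\zeta_1$; $\tilde b_ia_i\tilde b_i^{-1}=\zeta_1^{-1}a_i[b_i^{-1},\zeta_1^{-1}]$. *)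

theory Defs
  imports "HOL-Analysis.Analysis" "HOL-Algebra.Coset" "HOL-Algebra.Generated_Groups"
    "HOL-Combinatorics.Permutations"
begin

section \<open>Compact orientable surfaces with one boundary component\<close>

definition half_plane :: "complex set" where
  "half_plane = {z. Im z \<ge> 0}"

definition surface_with_boundary :: "'a topology \<Rightarrow> bool" where
  "surface_with_boundary X \<longleftrightarrow>
     Hausdorff_space X \<and> second_countable X \<and>
     (\<forall>x \<in> topspace X. \<exists>U V. openin X U \<and> x \<in> U \<and> openin (top_of_set half_plane) V \<and>
        subtopology X U homeomorphic_space top_of_set V)"

definition surface_interior :: "'a topology \<Rightarrow> 'a set" where
  "surface_interior X =
     {x \<in> topspace X. \<exists>U V. openin X U \<and> x \<in> U \<and> open (V :: complex set) \<and>
        subtopology X U homeomorphic_space top_of_set V}"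

definition surface_boundary :: "'a topology \<Rightarrow> 'a set" where
  "surface_boundary X = topspace X - surface_interior X"

text \<open>For surfaces, orientability means that no Moebius band embeds. The Moebius band is the unit
  square with \<open>(0, t)\<close> glued to \<open>(1, 1 - t)\<close>; as the square is compact, in a Hausdorff space a
  continuous map with exactly these identifications is an embedding of the band.\<close>

definition orientable_surface :: "'a topology \<Rightarrow> bool" where
  "orientable_surface X \<longleftrightarrow>
     \<not> (\<exists>f :: real \<times> real \<Rightarrow> 'a.
          continuous_map (top_of_set ({0..1} \<times> {0..1})) X f \<and>
          (\<forall>u \<in> {0..1} \<times> {0..1}. \<forall>v \<in> {0..1} \<times> {0..1}.
             f u = f v \<longleftrightarrow>
             u = v \<or> (fst u \<in> {0, 1} \<and> fst v = 1 - fst u \<and> snd v = 1 - snd u)))"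

text \<open>The genus is the largest number of disjoint simple closed curves whose union does not
  separate the surface. The curves have to lie in the interior: a boundary circle never separates.\<close>

definition nonseparating_curves :: "'a topology \<Rightarrow> 'a set set \<Rightarrow> bool" where
  "nonseparating_curves X \<C> \<longleftrightarrow>
     finite \<C> \<and> pairwise disjnt \<C> \<and>
     (\<forall>C \<in> \<C>. C \<subseteq> surface_interior X \<and>
        subtopology X C homeomorphic_space top_of_set (sphere (0 :: complex) 1)) \<and>
     connectedin X (topspace X - \<Union>\<C>)"

definition has_genus :: "'a topology \<Rightarrow> nat \<Rightarrow> bool" where
  "has_genus X g \<longleftrightarrow>
     (\<exists>\<C>. nonseparating_curves X \<C> \<and> card \<C> = g) \<and>
     (\<forall>\<C>. nonseparating_curves X \<C> \<longrightarrow> card \<C> \<le> g)"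

definition one_boundary_surface :: "nat \<Rightarrow> 'a topology \<Rightarrow> bool" where
  "one_boundary_surface g X \<longleftrightarrow>
     surface_with_boundary X \<and> compact_space X \<and> connected_space X \<and> orientable_surface X \<and>
     has_genus X g \<and> card (connected_components_of (subtopology X (surface_boundary X))) = 1"


section \<open>Fundamental groups and mixed braid groups\<close>

definition path_join :: "(real \<Rightarrow> 'a) \<Rightarrow> (real \<Rightarrow> 'a) \<Rightarrow> real \<Rightarrow> 'a" where
  "path_join p q = (\<lambda>t. if t \<le> 1/2 then p (2 * t) else q (2 * t - 1))"

definition loops :: "'a topology \<Rightarrow> 'a \<Rightarrow> (real \<Rightarrow> 'a) set" where
  "loops X x0 = {p. pathin X p \<and> p 0 = x0 \<and> p 1 = x0}"

definition loop_class :: "'a topology \<Rightarrow> 'a \<Rightarrow> (real \<Rightarrow> 'a) \<Rightarrow> (real \<Rightarrow> 'a) set" where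
  "loop_class X x0 p =
     {q. homotopic_with (\<lambda>h. h 0 = x0 \<and> h 1 = x0) (top_of_set {0..1}) X p q}"

definition fundamental_group :: "'a topology \<Rightarrow> 'a \<Rightarrow> (real \<Rightarrow> 'a) set monoid" where
  "fundamental_group X x0 =
     \<lparr>carrier = loop_class X x0 ` loops X x0,
      mult = (\<lambda>A B. \<Union>p\<in>A. \<Union>q\<in>B. loop_class X x0 (path_join p q)),
      one = loop_class X x0 (\<lambda>_. x0)\<rparr>"

definition quotient_topology :: "'a topology \<Rightarrow> ('a \<Rightarrow> 'b) \<Rightarrow> 'b topology" where
  "quotient_topology X f =
     topology (\<lambda>U. U \<subseteq> f ` topspace X \<and> openin X {x \<in> topspace X. f x \<in> U})"

lemma openin_quotient_topology:
  "openin (quotient_topology X f) U \<longleftrightarrow>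
     U \<subseteq> f ` topspace X \<and> openin X {x \<in> topspace X. f x \<in> U}"
proof -
  have "istopology (\<lambda>U. U \<subseteq> f ` topspace X \<and> openin X {x \<in> topspace X. f x \<in> U})"
  proof -
    have "openin X {x \<in> topspace X. f x \<in> S \<inter> T}"
      if "openin X {x \<in> topspace X. f x \<in> S}" "openin X {x \<in> topspace X. f x \<in> T}" for S T
    proof -
      have "{x \<in> topspace X. f x \<in> S \<inter> T} =
            {x \<in> topspace X. f x \<in> S} \<inter> {x \<in> topspace X. f x \<in> T}" by blast
      then show ?thesis using that by (simp add: openin_Int)
    qed
    moreover have "openin X {x \<in> topspace X. f x \<in> \<Union>K}"
      if "\<forall>S\<in>K. openin X {x \<in> topspace X. f x \<in> S}" for K
    proof -
      have "{x \<in> topspace X. f x \<in> \<Union>K} = (\<Union>S\<in>K. {x \<in> topspace X. f x \<in> S})" by blast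
      then show ?thesis using that by auto
    qed
    ultimately show ?thesis unfolding istopology_def by blast
  qed
  then show ?thesis by (simp add: quotient_topology_def)
qed

lemma quotient_map_quotient_topology: "quotient_map X (quotient_topology X f) f"
proof -
  have "{x \<in> topspace X. f x \<in> f ` topspace X} = topspace X" by blast
  then have "openin (quotient_topology X f) (f ` topspace X)"
    by (simp add: openin_quotient_topology)
  then have "topspace (quotient_topology X f) = f ` topspace X"
    by (metis openin_quotient_topology openin_subset openin_topspace subset_antisym)
  then show ?thesis by (auto simp: quotient_map_def openin_quotient_topology)
qed

definition config_space :: "nat \<Rightarrow> 'a topology \<Rightarrow> (nat \<Rightarrow> 'a) topology" where
  "config_space m X =
     subtopology (product_topology (\<lambda>_. X) {1..m})
       {x. \<forall>i\<in>{1..m}. \<forall>j\<in>{1..m}. i \<noteq> j \<longrightarrow> x i \<noteq> x j}"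

text \<open>The subgroup \<open>S\<^sub>k \<times> S\<^sub>n\<close> of the symmetric group on \<open>{1..k+n}\<close>.\<close>

definition mixed_perms :: "nat \<Rightarrow> nat \<Rightarrow> (nat \<Rightarrow> nat) set" where
  "mixed_perms k n = {p. p permutes {1..k + n} \<and> p ` {1..k} = {1..k}}"

definition mixed_config_space :: "nat \<Rightarrow> nat \<Rightarrow> 'a topology \<Rightarrow> (nat \<Rightarrow> 'a) set topology" where
  "mixed_config_space k n X =
     quotient_topology (config_space (k + n) X) (\<lambda>x. {x \<circ> p | p. p \<in> mixed_perms k n})"

definition mixed_braid_group ::
    "nat \<Rightarrow> nat \<Rightarrow> 'a topology \<Rightarrow> (nat \<Rightarrow> 'a) set \<Rightarrow> (real \<Rightarrow> (nat \<Rightarrow> 'a) set) set monoid" where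
  "mixed_braid_group k n X x0 = fundamental_group (mixed_config_space k n X) x0"


section \<open>Lower central series\<close>

definition commutator_subgroup :: "('a, 'b) monoid_scheme \<Rightarrow> 'a set \<Rightarrow> 'a set \<Rightarrow> 'a set" where
  "commutator_subgroup G H K =
     generate G {x \<otimes>\<^bsub>G\<^esub> y \<otimes>\<^bsub>G\<^esub> inv\<^bsub>G\<^esub> x \<otimes>\<^bsub>G\<^esub> inv\<^bsub>G\<^esub> y | x y. x \<in> H \<and> y \<in> K}"

text \<open>The series is indexed from 1; index 0 is a dummy.\<close>

fun lower_central :: "('a, 'b) monoid_scheme \<Rightarrow> nat \<Rightarrow> 'a set" where
  "lower_central G 0 = carrier G"
| "lower_central G (Suc 0) = carrier G"
| "lower_central G (Suc (Suc i)) = commutator_subgroup G (carrier G) (lower_central G (Suc i))"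


section \<open>Group presentations\<close>

text \<open>A letter \<open>(x, True)\<close> stands for the generator \<open>x\<close> and \<open>(x, False)\<close> for its inverse. A relation
  \<open>u = v\<close> is the pair of words \<open>(u, v)\<close>.\<close>

type_synonym 'x word = "('x \<times> bool) list"

abbreviation letter :: "'x \<Rightarrow> 'x word" (\<open>\<langle>_\<rangle>\<close>) where
  "\<langle>x\<rangle> \<equiv> [(x, True)]"

definition winv :: "'x word \<Rightarrow> 'x word" where
  "winv w = rev (map (\<lambda>(x, e). (x, \<not> e)) w)"

definition wcomm :: "'x word \<Rightarrow> 'x word \<Rightarrow> 'x word" where
  "wcomm u v = u @ v @ winv u @ winv v"

text \<open>\<open>wpow x y\<close> is \<open>x\<^sup>y = y\<^sup>-\<^sup>1 x y\<close>, whereas \<open>wconj x y\<close> is \<open>x y x\<^sup>-\<^sup>1\<close>.\<close>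

definition wpow :: "'x word \<Rightarrow> 'x word \<Rightarrow> 'x word" where
  "wpow x y = winv y @ x @ y"

definition wconj :: "'x word \<Rightarrow> 'x word \<Rightarrow> 'x word" where
  "wconj x y = x @ y @ winv x"

definition wcommute :: "'x word \<Rightarrow> 'x word \<Rightarrow> 'x word \<times> 'x word" where
  "wcommute u v = (u @ v, v @ u)"

definition words :: "'x set \<Rightarrow> 'x word set" where
  "words X = lists (X \<times> UNIV)"

definition weval :: "('a, 'b) monoid_scheme \<Rightarrow> ('x \<Rightarrow> 'a) \<Rightarrow> 'x word \<Rightarrow> 'a" where
  "weval G s w =
     foldr (\<lambda>(x, e) y. (if e then s x else inv\<^bsub>G\<^esub> (s x)) \<otimes>\<^bsub>G\<^esub> y) w \<one>\<^bsub>G\<^esub>"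

text \<open>Equality of words in the group generated by \<open>X\<close> subject to the relations \<open>R\<close>.\<close>

inductive pres_eq :: "'x set \<Rightarrow> ('x word \<times> 'x word) set \<Rightarrow> 'x word \<Rightarrow> 'x word \<Rightarrow> bool"
  for X :: "'x set" and R :: "('x word \<times> 'x word) set" where
  rel: "(u, v) \<in> R \<Longrightarrow> pres_eq X R u v"
| cancel: "x \<in> X \<Longrightarrow> pres_eq X R [(x, e), (x, \<not> e)] []"
| refl: "pres_eq X R u u"
| sym: "pres_eq X R u v \<Longrightarrow> pres_eq X R v u"
| trans: "pres_eq X R u v \<Longrightarrow> pres_eq X R v w \<Longrightarrow> pres_eq X R u w"
| cong: "pres_eq X R u u' \<Longrightarrow> pres_eq X R v v' \<Longrightarrow> pres_eq X R (u @ v) (u' @ v')"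

text \<open>\<open>G\<close> admits the presentation with generators \<open>X\<close> and relations \<open>R\<close>, the generator \<open>x\<close> being
  the element \<open>s x\<close> of \<open>G\<close>: evaluation of words induces an isomorphism from the presented group.\<close>

definition has_presentation ::
    "('a, 'b) monoid_scheme \<Rightarrow> ('x \<Rightarrow> 'a) \<Rightarrow> 'x set \<Rightarrow> ('x word \<times> 'x word) set \<Rightarrow> bool" where
  "has_presentation G s X R \<longleftrightarrow>
     group G \<and> s ` X \<subseteq> carrier G \<and> R \<subseteq> words X \<times> words X \<and>
     weval G s ` words X = carrier G \<and>
     (\<forall>u \<in> words X. \<forall>v \<in> words X. weval G s u = weval G s v \<longleftrightarrow> pres_eq X R u v)"


section \<open>The presentation of the mixed braid group\<close>

text \<open>The prefix \<open>T\<close> stands for the tilde.\<close>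

datatype bgen = Sig nat | TSig nat | A nat | B nat | TA nat | TB nat | Zeta nat

definition gens_S :: "nat \<Rightarrow> bgen set" where "gens_S k = Sig ` {1..<k}"
definition gens_TS :: "nat \<Rightarrow> bgen set" where "gens_TS n = TSig ` {1..<n}"
definition gens_AB :: "nat \<Rightarrow> bgen set" where "gens_AB g = A ` {1..g} \<union> B ` {1..g}"
definition gens_TAB :: "nat \<Rightarrow> bgen set" where "gens_TAB g = TA ` {1..g} \<union> TB ` {1..g}"
definition gens_Z :: "nat \<Rightarrow> bgen set" where "gens_Z n = Zeta ` {1..n}"

definition braid_gens :: "nat \<Rightarrow> nat \<Rightarrow> nat \<Rightarrow> bgen set" where
  "braid_gens k n g = gens_S k \<union> gens_TS n \<union> gens_AB g \<union> gens_TAB g \<union> gens_Z n"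

text \<open>The relations of the \<open>m\<close>-strand braid group of the surface, with \<open>\<sigma>\<^sub>i, a\<^sub>i, b\<^sub>i\<close> named
  \<open>s i, a i, b i\<close>.\<close>

definition surface_braid_rels ::
    "nat \<Rightarrow> nat \<Rightarrow> (nat \<Rightarrow> 'x) \<Rightarrow> (nat \<Rightarrow> 'x) \<Rightarrow> (nat \<Rightarrow> 'x) \<Rightarrow> ('x word \<times> 'x word) set" where
  "surface_braid_rels m g s a b =
     {wcommute \<langle>s i\<rangle> \<langle>s j\<rangle> | i j.
        i \<in> {1..<m} \<and> j \<in> {1..<m} \<and> (i + 2 \<le> j \<or> j + 2 \<le> i)} \<union>
     {(\<langle>s i\<rangle> @ \<langle>s (i + 1)\<rangle> @ \<langle>s i\<rangle>, \<langle>s (i + 1)\<rangle> @ \<langle>s i\<rangle> @ \<langle>s (i + 1)\<rangle>) | i.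
        i \<in> {1..<m} \<and> i + 1 \<in> {1..<m}} \<union>
     {wcommute \<langle>c\<rangle> \<langle>s i\<rangle> | c i.
        i \<in> {1..<m} \<and> i \<noteq> 1 \<and> c \<in> a ` {1..g} \<union> b ` {1..g}} \<union>
     {(\<langle>c\<rangle> @ \<langle>s 1\<rangle> @ \<langle>c\<rangle> @ \<langle>s 1\<rangle>, \<langle>s 1\<rangle> @ \<langle>c\<rangle> @ \<langle>s 1\<rangle> @ \<langle>c\<rangle>) | c.
        1 < m \<and> c \<in> a ` {1..g} \<union> b ` {1..g}} \<union>
     {(\<langle>a i\<rangle> @ \<langle>s 1\<rangle> @ \<langle>b i\<rangle>, \<langle>s 1\<rangle> @ \<langle>b i\<rangle> @ \<langle>s 1\<rangle> @ \<langle>a i\<rangle> @ \<langle>s 1\<rangle>) | i.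
        1 < m \<and> i \<in> {1..g}} \<union>
     {wcommute (winv \<langle>s 1\<rangle> @ \<langle>c\<rangle> @ \<langle>s 1\<rangle>) \<langle>d\<rangle> | c d i j.
        1 < m \<and> i \<in> {1..g} \<and> j \<in> {1..g} \<and> i < j \<and> c \<in> {a i, b i} \<and> d \<in> {a j, b j}}"

definition zeta_rels :: "nat \<Rightarrow> nat \<Rightarrow> nat \<Rightarrow> (bgen word \<times> bgen word) set" where
  "zeta_rels k n g =
     {wcommute \<langle>Zeta j\<rangle> \<langle>Sig i\<rangle> | i j. i \<in> {1..<k} \<and> i \<noteq> 1 \<and> j \<in> {1..n}} \<union>
     {(\<langle>Zeta j\<rangle> @ \<langle>Sig 1\<rangle> @ \<langle>Zeta j\<rangle> @ \<langle>Sig 1\<rangle>, \<langle>Sig 1\<rangle> @ \<langle>Zeta j\<rangle> @ \<langle>Sig 1\<rangle> @ \<langle>Zeta j\<rangle>) | j.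
        1 < k \<and> j \<in> {1..n}} \<union>
     {wcommute (winv \<langle>Sig 1\<rangle> @ \<langle>Zeta i\<rangle> @ \<langle>Sig 1\<rangle>) \<langle>c\<rangle> | c i.
        1 < k \<and> i \<in> {1..n} \<and> c \<in> gens_AB g} \<union>
     {wcommute (winv \<langle>Sig 1\<rangle> @ \<langle>Zeta i\<rangle> @ \<langle>Sig 1\<rangle>) \<langle>Zeta j\<rangle> | i j.
        1 < k \<and> i \<in> {1..n} \<and> j \<in> {1..n} \<and> i < j}"

definition tilde_pairs :: "nat \<Rightarrow> (bgen \<times> bgen) set" where
  "tilde_pairs i = {(TA i, A i), (TB i, B i)}"

definition mixed_rels :: "nat \<Rightarrow> nat \<Rightarrow> nat \<Rightarrow> (bgen word \<times> bgen word) set" where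
  "mixed_rels k n g =
     {wcommute \<langle>c\<rangle> \<langle>Sig j\<rangle> | c j. c \<in> gens_TS n \<union> gens_TAB g \<and> j \<in> {1..<k}} \<union>
     {wcommute \<langle>TSig i\<rangle> \<langle>c\<rangle> | i c. i \<in> {1..<n} \<and> c \<in> gens_AB g} \<union>
     {(wconj \<langle>TSig i\<rangle> \<langle>Zeta (i + 1)\<rangle>, \<langle>Zeta i\<rangle>) | i. i \<in> {1..<n}} \<union>
     {(wconj \<langle>TSig i\<rangle> \<langle>Zeta i\<rangle>, winv \<langle>Zeta i\<rangle> @ \<langle>Zeta (i + 1)\<rangle> @ \<langle>Zeta i\<rangle>) | i. i \<in> {1..<n}} \<union>
     {(wconj \<langle>TSig i\<rangle> \<langle>Zeta j\<rangle>, \<langle>Zeta j\<rangle>) | i j.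
        i \<in> {1..<n} \<and> j \<in> {1..n} \<and> j \<noteq> i \<and> j \<noteq> i + 1} \<union>
     {(wconj \<langle>x'\<rangle> \<langle>Zeta 1\<rangle>, wpow \<langle>Zeta 1\<rangle> (\<langle>x\<rangle> @ \<langle>Zeta 1\<rangle>)) | x' x i.
        1 \<le> n \<and> i \<in> {1..g} \<and> (x', x) \<in> tilde_pairs i} \<union>
     {(wconj \<langle>x'\<rangle> \<langle>Zeta j\<rangle>, wpow \<langle>Zeta j\<rangle> (wcomm (winv \<langle>x\<rangle>) (winv \<langle>Zeta 1\<rangle>))) | x' x i j.
        i \<in> {1..g} \<and> j \<in> {1..n} \<and> j \<noteq> 1 \<and> (x', x) \<in> tilde_pairs i} \<union>
     {(wconj \<langle>x'\<rangle> \<langle>x\<rangle>, winv \<langle>Zeta 1\<rangle> @ \<langle>x\<rangle> @ \<langle>Zeta 1\<rangle>) | x' x i.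
        1 \<le> n \<and> i \<in> {1..g} \<and> (x', x) \<in> tilde_pairs i} \<union>
     {(wconj \<langle>x'\<rangle> \<langle>d\<rangle>, wpow \<langle>d\<rangle> (wcomm (winv \<langle>x\<rangle>) (winv \<langle>Zeta 1\<rangle>))) | x' x d i j.
        1 \<le> n \<and> i \<in> {1..g} \<and> j \<in> {1..g} \<and> i > j \<and> (x', x) \<in> tilde_pairs i \<and> d \<in> {A j, B j}} \<union>
     {(wconj \<langle>x'\<rangle> \<langle>d\<rangle>, \<langle>d\<rangle>) | x' x d i j.
        i \<in> {1..g} \<and> j \<in> {1..g} \<and> j > i \<and> (x', x) \<in> tilde_pairs i \<and> d \<in> {A j, B j}} \<union>
     {(wconj \<langle>TA i\<rangle> \<langle>B i\<rangle>, \<langle>B i\<rangle> @ \<langle>Zeta 1\<rangle>) | i. 1 \<le> n \<and> i \<in> {1..g}} \<union>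
     {(wconj \<langle>TB i\<rangle> \<langle>A i\<rangle>,
        winv \<langle>Zeta 1\<rangle> @ \<langle>A i\<rangle> @ wcomm (winv \<langle>B i\<rangle>) (winv \<langle>Zeta 1\<rangle>)) | i. 1 \<le> n \<and> i \<in> {1..g}}"

definition braid_rels :: "nat \<Rightarrow> nat \<Rightarrow> nat \<Rightarrow> (bgen word \<times> bgen word) set" where
  "braid_rels k n g =
     surface_braid_rels k g Sig A B \<union> zeta_rels k n g \<union>
     surface_braid_rels n g TSig TA TB \<union>
     mixed_rels k n g"


section \<open>The presentation of the class-two quotient\<close>

datatype qgen = QSig | QTSig | QZeta | QA nat | QB nat | QTA nat | QTB nat

definition quotient_gens :: "nat \<Rightarrow> qgen set" where
  "quotient_gens g =
     {QSig, QTSig, QZeta} \<union> QA ` {1..g} \<union> QB ` {1..g} \<union> QTA ` {1..g} \<union> QTB ` {1..g}"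

definition noncommuting_pairs :: "nat \<Rightarrow> qgen set set" where
  "noncommuting_pairs g =
     (\<Union>i\<in>{1..g}. {{QA i, QB i}, {QTA i, QTB i}, {QB i, QTA i}, {QTB i, QA i}})"

definition quotient_rels :: "nat \<Rightarrow> (qgen word \<times> qgen word) set" where
  "quotient_rels g =
     {wcommute \<langle>x\<rangle> \<langle>y\<rangle> | x y.
        x \<in> quotient_gens g \<and> y \<in> quotient_gens g \<and> x \<noteq> y \<and> {x, y} \<notin> noncommuting_pairs g} \<union>
     {(wcomm \<langle>QA i\<rangle> \<langle>QB i\<rangle>, \<langle>QSig\<rangle> @ \<langle>QSig\<rangle>) | i. i \<in> {1..g}} \<union>
     {(wcomm \<langle>QTA i\<rangle> \<langle>QTB i\<rangle>, \<langle>QTSig\<rangle> @ \<langle>QTSig\<rangle>) | i. i \<in> {1..g}} \<union>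
     {(wcomm \<langle>QA i\<rangle> \<langle>QTB i\<rangle>, \<langle>QZeta\<rangle>) | i. i \<in> {1..g}} \<union>
     {(wcomm \<langle>QTA i\<rangle> \<langle>QB i\<rangle>, \<langle>QZeta\<rangle>) | i. i \<in> {1..g}}"

end

theory Submission
  imports Defs
begin

text \<open>
  In a group of nilpotency class two a braid relation \<open>xyx = yxy\<close> forces \<open>x = y\<close>. Hence in the
  quotient by \<open>\<Gamma>\<^sub>3\<close> all \<open>\<sigma>\<^sub>i\<close> agree, their tilde versions agree, and then, as \<open>n \<ge> 3\<close>, all \<open>\<zeta>\<^sub>i\<close> agree. Since
  \<open>\<sigma>\<^sub>2\<close> commutes with \<open>AB \<union> Z\<close>, the common values are central and the remaining relations
  collapse to the stated ones. Conversely, the group \<open>P\<close> with the stated presentation satisfies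
  every braid relation after the same identification of generators and has class two because the
  commutators of its generators are central. So von Dyck's theorem gives a homomorphism from the
  braid group to \<open>P\<close> that kills \<open>\<Gamma>\<^sub>3\<close>, and the induced map is inverse to the obvious one.
\<close>

section \<open>Words and presented groups\<close>

text \<open>The bounds k, n >= 3 say that both families of braid generators have a second member,
  and index 2 drives the collapse. Elements of AB and Z commute with \<open>\<sigma>\<^sub>2\<close>
  by a defining relation, whereas their relations with \<open>\<sigma>\<^sub>1\<close> are weaker;
  likewise the tilde version of \<open>\<sigma>\<^sub>2\<close> fixes
  \<open>\<zeta>\<^sub>1\<close>, whereas that of \<open>\<sigma>\<^sub>1\<close> moves it. Once the
  indices are identified, these commutations hold for the common values. The order of the deductions
  is forced as well: \<zeta> has to commute with AB first. The tilde generators act through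
  conjugation by \<open>x\<zeta>\<^sub>1\<close>, \<open>\<zeta>\<^sub>1\<close> and
  \<open>[x^-1, \<zeta>\<^sub>1^-1]\<close>, and these conjugations become trivial on the relevant
  elements only after that.\<close>

lemma words_Nil [simp]: "[] \<in> words X"
  by (simp add: words_def)

lemma words_Cons [simp]: "p # w \<in> words X \<longleftrightarrow> fst p \<in> X \<and> w \<in> words X"
  by (cases p) (auto simp: words_def)

lemma words_append [simp]: "u @ v \<in> words X \<longleftrightarrow> u \<in> words X \<and> v \<in> words X"
  by (auto simp: words_def)

lemma winv_Nil [simp]: "winv [] = []"
  by (simp add: winv_def)

lemma winv_Cons: "winv (p # w) = winv w @ [(fst p, \<not> snd p)]"
  by (cases p) (simp add: winv_def)

lemma words_winv [simp]: "winv w \<in> words X \<longleftrightarrow> w \<in> words X"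
  by (induction w) (auto simp: winv_Cons)

lemma weval_Nil [simp]: "weval G s [] = \<one>\<^bsub>G\<^esub>"
  by (simp add: weval_def)

lemma weval_Cons:
  "weval G s (p # w) = (if snd p then s (fst p) else inv\<^bsub>G\<^esub> (s (fst p))) \<otimes>\<^bsub>G\<^esub> weval G s w"
  by (cases p) (simp add: weval_def)

lemma weval_map:
  "weval G s (map (\<lambda>p. (r (fst p), snd p)) w) = weval G (s \<circ> r) w"
  by (induction w) (simp_all add: weval_Cons)

lemma weval_cong:
  assumes "w \<in> words X" "\<And>x. x \<in> X \<Longrightarrow> s x = t x"
  shows "weval G s w = weval G t w"
  using assms(1) by (induction w) (simp_all add: weval_Cons assms(2))

context group
begin

lemma weval_closed:
  assumes "s ` X \<subseteq> carrier G" "w \<in> words X"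
  shows "weval G s w \<in> carrier G"
  using assms(2) by (induction w) (use assms(1) in \<open>auto simp: weval_Cons\<close>)

lemma weval_append:
  assumes "s ` X \<subseteq> carrier G" "u \<in> words X" "v \<in> words X"
  shows "weval G s (u @ v) = weval G s u \<otimes> weval G s v"
  using assms(2)
proof (induction u)
  case (Cons p u)
  then have "s (fst p) \<in> carrier G" "weval G s u \<in> carrier G" "weval G s v \<in> carrier G"
    using assms(1,3) weval_closed[OF assms(1)] by auto
  with Cons show ?case
    by (simp add: weval_Cons m_assoc)
qed (use weval_closed[OF assms(1,3)] in simp)

lemma weval_winv:
  assumes "s ` X \<subseteq> carrier G" "w \<in> words X"
  shows "weval G s (winv w) = inv (weval G s w)"
  using assms(2)
proof (induction w)
  case (Cons p w)
  then have "s (fst p) \<in> carrier G" "weval G s w \<in> carrier G"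
    using assms(1) weval_closed[OF assms(1)] by auto
  with Cons show ?case
    by (simp add: winv_Cons weval_append[OF assms(1)] weval_Cons inv_mult_group)
qed simp

lemma weval_in_generate:
  assumes "w \<in> words X"
  shows "weval G s w \<in> generate G (s ` X)"
  using assms
proof (induction w)
  case (Cons p w)
  then show ?case
    by (auto simp: weval_Cons intro!: generate.eng intro: generate.incl generate.inv)
qed (simp add: generate.one)

end

lemma weval_hom:
  assumes "group_hom G H h" "s ` X \<subseteq> carrier G" "w \<in> words X"
  shows "h (weval G s w) = weval H (h \<circ> s) w"
proof -
  interpret group_hom G H h by fact
  show ?thesis
    using assms(3)
  proof (induction w)
    case (Cons p w)
    then have "s (fst p) \<in> carrier G" "weval G s w \<in> carrier G"
      using assms(2) G.weval_closed[OF assms(2)] by auto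
    with Cons show ?case
      by (simp add: weval_Cons)
  qed simp
qed

section \<open>Soundness of derivations from relations\<close>

definition satisfies ::
    "('a, 'b) monoid_scheme \<Rightarrow> ('x \<Rightarrow> 'a) \<Rightarrow> ('x word \<times> 'x word) set \<Rightarrow> bool" where
  "satisfies G s R \<longleftrightarrow> (\<forall>(u, v)\<in>R. weval G s u = weval G s v)"

lemma satisfies_Un [simp]: "satisfies G s (R \<union> T) \<longleftrightarrow> satisfies G s R \<and> satisfies G s T"
  by (auto simp: satisfies_def)

text \<open>The rule \<open>refl\<close> admits arbitrary letters, so \<open>pres_eq\<close> is not
  confined to \<open>words X\<close> by definition. Every rule preserves membership in both
  directions; inductions need this for the middle word of \<open>trans\<close> and for
  \<open>sym\<close>.\<close>

lemma pres_eq_words: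
  assumes "pres_eq X R u v" "R \<subseteq> words X \<times> words X"
  shows "u \<in> words X \<longleftrightarrow> v \<in> words X"
  using assms by induction auto

text \<open>Soundness of \<open>pres_eq\<close>. A condition on the left word suffices, as
  \<open>pres_eq_words\<close> carries it to the right one.\<close>

lemma (in group) pres_eq_imp_weval_eq:
  assumes "pres_eq X R u v" "R \<subseteq> words X \<times> words X" "s ` X \<subseteq> carrier G"
    and "satisfies G s R" "u \<in> words X"
  shows "weval G s u = weval G s v"
  using assms(1,5)
proof induction
  case (rel u v)
  then show ?case using assms(4) by (auto simp: satisfies_def)
next
  case (cancel x e)
  then show ?case using assms(3) by (auto simp: weval_Cons)
next
  case (sym u v)
  then show ?case using pres_eq_words[OF _ assms(2)] by metis
next
  case (trans u v w)
  then show ?case using pres_eq_words[OF _ assms(2)] by metis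
next
  case (cong u u' v v')
  then have "u' \<in> words X" "v' \<in> words X"
    using pres_eq_words[OF _ assms(2)] by (metis words_append)+
  with cong show ?case
    by (simp add: weval_append[OF assms(3)])
qed simp

section \<open>The group defined by a presentation\<close>

definition pres_class :: "'x set \<Rightarrow> ('x word \<times> 'x word) set \<Rightarrow> 'x word \<Rightarrow> 'x word set" where
  "pres_class X R u = {v \<in> words X. pres_eq X R u v}"

text \<open>The quotient of the free group on \<open>X\<close>, built directly from words because
  \<open>pres_eq\<close> already contains free cancellation. The product is a union over all
  representatives; by \<open>pres_eq.cong\<close> all sets in that union coincide, so no
  representative has to be chosen.\<close>

definition presented_group :: "'x set \<Rightarrow> ('x word \<times> 'x word) set \<Rightarrow> 'x word set monoid" where
  "presented_group X R =
     \<lparr>carrier = pres_class X R ` words X,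
      mult = (\<lambda>C D. \<Union>u\<in>C. \<Union>v\<in>D. pres_class X R (u @ v)),
      one = pres_class X R []\<rparr>"

lemma pres_class_eq_iff:
  assumes "u \<in> words X" "v \<in> words X"
  shows "pres_class X R u = pres_class X R v \<longleftrightarrow> pres_eq X R u v"
proof
  assume "pres_class X R u = pres_class X R v"
  moreover have "v \<in> pres_class X R v"
    using assms by (simp add: pres_class_def pres_eq.refl)
  ultimately have "v \<in> pres_class X R u" by simp
  then show "pres_eq X R u v"
    by (simp add: pres_class_def)
next
  assume "pres_eq X R u v"
  then have "pres_eq X R u w \<longleftrightarrow> pres_eq X R v w" for w
    using pres_eq.sym pres_eq.trans by metis
  then show "pres_class X R u = pres_class X R v"
    by (simp add: pres_class_def)
qed

lemma pres_class_mult: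
  assumes "u \<in> words X" "v \<in> words X"
  shows "pres_class X R u \<otimes>\<^bsub>presented_group X R\<^esub> pres_class X R v = pres_class X R (u @ v)"
proof -
  have class_eq: "pres_class X R (u' @ v') = pres_class X R (u @ v)"
    if "u' \<in> pres_class X R u" "v' \<in> pres_class X R v" for u' v'
  proof -
    have "u' \<in> words X" "v' \<in> words X" "pres_eq X R (u @ v) (u' @ v')"
      using that by (auto simp: pres_class_def intro: pres_eq.cong)
    then show ?thesis
      using assms by (simp add: pres_class_eq_iff pres_eq.sym)
  qed
  have "u \<in> pres_class X R u" "v \<in> pres_class X R v"
    using assms by (simp_all add: pres_class_def pres_eq.refl)
  then have "(\<Union>u'\<in>pres_class X R u. \<Union>v'\<in>pres_class X R v. pres_class X R (u' @ v'))
      = pres_class X R (u @ v)"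
    using class_eq by blast
  then show ?thesis
    by (simp add: presented_group_def)
qed

lemma pres_eq_winv_left:
  assumes "w \<in> words X"
  shows "pres_eq X R (winv w @ w) []"
  using assms
proof (induction w)
  case (Cons p w)
  obtain x e where p: "p = (x, e)" by fastforce
  have "pres_eq X R [(x, \<not> e), (x, e)] []"
    using pres_eq.cancel[of x X R "\<not> e"] Cons p by simp
  then have "pres_eq X R (winv w @ ([(x, \<not> e), (x, e)] @ w)) (winv w @ ([] @ w))"
    by (intro pres_eq.cong pres_eq.refl)
  moreover have "pres_eq X R (winv w @ w) []"
    using Cons by simp
  ultimately show ?case
    using p by (auto simp: winv_Cons intro: pres_eq.trans)
qed (simp add: pres_eq.refl)

lemma group_presented_group: "group (presented_group X R)"
proof (rule groupI)
  let ?P = "presented_group X R"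
  have carr: "carrier ?P = pres_class X R ` words X" and one: "\<one>\<^bsub>?P\<^esub> = pres_class X R []"
    by (simp_all add: presented_group_def)
  show "\<one>\<^bsub>?P\<^esub> \<in> carrier ?P"
    unfolding carr one by simp
  fix C assume "C \<in> carrier ?P"
  then obtain u where u: "C = pres_class X R u" "u \<in> words X"
    using carr by auto
  show "\<one>\<^bsub>?P\<^esub> \<otimes>\<^bsub>?P\<^esub> C = C"
    using u by (simp add: one pres_class_mult)
  have "pres_class X R (winv u) \<otimes>\<^bsub>?P\<^esub> C = \<one>\<^bsub>?P\<^esub>"
    using u by (simp add: one pres_class_mult pres_class_eq_iff pres_eq_winv_left)
  then show "\<exists>D\<in>carrier ?P. D \<otimes>\<^bsub>?P\<^esub> C = \<one>\<^bsub>?P\<^esub>"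
    using u carr by auto
  fix D assume "D \<in> carrier ?P"
  then obtain v where v: "D = pres_class X R v" "v \<in> words X"
    using carr by auto
  show "C \<otimes>\<^bsub>?P\<^esub> D \<in> carrier ?P"
    using u v by (simp add: carr pres_class_mult)
  fix E assume "E \<in> carrier ?P"
  then obtain w where w: "E = pres_class X R w" "w \<in> words X"
    using carr by auto
  show "C \<otimes>\<^bsub>?P\<^esub> D \<otimes>\<^bsub>?P\<^esub> E = C \<otimes>\<^bsub>?P\<^esub> (D \<otimes>\<^bsub>?P\<^esub> E)"
    using u v w by (simp add: pres_class_mult)
qed

abbreviation pres_gen :: "'x set \<Rightarrow> ('x word \<times> 'x word) set \<Rightarrow> 'x \<Rightarrow> 'x word set" where
  "pres_gen X R x \<equiv> pres_class X R [(x, True)]"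

lemma weval_presented_group:
  assumes "w \<in> words X"
  shows "weval (presented_group X R) (pres_gen X R) w = pres_class X R w"
  using assms
proof (induction w)
  case Nil
  then show ?case by (simp add: presented_group_def)
next
  case (Cons p w)
  obtain x e where p: "p = (x, e)" by fastforce
  interpret group "presented_group X R" by (rule group_presented_group)
  have x: "x \<in> X" "w \<in> words X" using Cons p by auto
  have "pres_class X R [(x, False)] \<otimes>\<^bsub>presented_group X R\<^esub> pres_gen X R x = \<one>\<^bsub>presented_group X R\<^esub>"
    using x pres_eq_winv_left[of "[(x, True)]" X R]
    by (simp add: pres_class_mult pres_class_eq_iff winv_Cons) (simp add: presented_group_def pres_class_eq_iff)
  then have "inv\<^bsub>presented_group X R\<^esub> (pres_gen X R x) = pres_class X R [(x, False)]"
    using x by (intro inv_equality) (simp_all add: presented_group_def)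
  then show ?case
    using Cons x p by (cases e) (simp_all add: weval_Cons pres_class_mult)
qed

text \<open>Evaluating a word at the generators returns its own class, so equality of values is
  \<open>pres_eq\<close> itself.\<close>

lemma has_presentation_presented_group:
  assumes "R \<subseteq> words X \<times> words X"
  shows "has_presentation (presented_group X R) (pres_gen X R) X R"
proof -
  have "weval (presented_group X R) (pres_gen X R) ` words X = carrier (presented_group X R)"
    by (simp add: presented_group_def weval_presented_group[unfolded presented_group_def])
  moreover have "pres_gen X R ` X \<subseteq> carrier (presented_group X R)"
    by (auto simp: presented_group_def)
  ultimately show ?thesis
    using assms group_presented_group
    by (auto simp: has_presentation_def weval_presented_group pres_class_eq_iff)
qed

section \<open>Consequences of having a presentation, and von Dyck's theorem\<close>

lemma has_presentation_satisfies:
  assumes "has_presentation G s X R"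
  shows "satisfies G s R"
  unfolding satisfies_def
proof clarify
  fix u v assume uv: "(u, v) \<in> R"
  then have "u \<in> words X" "v \<in> words X"
    using assms by (auto simp: has_presentation_def)
  then show "weval G s u = weval G s v"
    using assms pres_eq.rel[OF uv] by (simp add: has_presentation_def)
qed

lemma has_presentation_generate:
  assumes "has_presentation G s X R"
  shows "generate G (s ` X) = carrier G"
proof -
  interpret group G using assms by (simp add: has_presentation_def)
  show ?thesis
  proof
    show "generate G (s ` X) \<subseteq> carrier G"
      using assms by (intro generate_incl) (simp add: has_presentation_def)
    have "weval G s ` words X \<subseteq> generate G (s ` X)"
      by (auto intro: weval_in_generate)
    then show "carrier G \<subseteq> generate G (s ` X)"
      using assms by (simp add: has_presentation_def)
  qed
qed

lemma von_Dyck: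
  assumes G: "has_presentation G s X R"
    and H: "group H" "t ` X \<subseteq> carrier H" "satisfies H t R"
  obtains h where "group_hom G H h" "\<And>x. x \<in> X \<Longrightarrow> h (s x) = t x"
proof -
  interpret G: group G using G by (simp add: has_presentation_def)
  interpret H: group H by fact
  have s: "s ` X \<subseteq> carrier G" and R: "R \<subseteq> words X \<times> words X"
    and surj: "weval G s ` words X = carrier G"
    and eq: "\<And>u v. u \<in> words X \<Longrightarrow> v \<in> words X \<Longrightarrow> weval G s u = weval G s v \<longleftrightarrow> pres_eq X R u v"
    using G by (auto simp: has_presentation_def)
  \<comment> \<open>Any word with value \<open>y\<close> would do: two such words are
    \<open>pres_eq\<close> by the presentation of \<open>G\<close>, hence have the same value in
    \<open>H\<close> by soundness.\<close>
  define h where "h y = weval H t (inv_into (words X) (weval G s) y)" for y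
  have h: "h (weval G s u) = weval H t u" if "u \<in> words X" for u
  proof -
    let ?u = "inv_into (words X) (weval G s) (weval G s u)"
    have "?u \<in> words X" "weval G s ?u = weval G s u"
      using that by (auto intro: inv_into_into f_inv_into_f)
    then have "weval H t ?u = weval H t u"
      using that eq H.pres_eq_imp_weval_eq[OF _ R H(2,3)] by blast
    then show ?thesis by (simp add: h_def)
  qed
  have "h \<in> hom G H"
  proof (rule homI)
    fix y assume "y \<in> carrier G"
    then obtain u where u: "y = weval G s u" "u \<in> words X" using surj by blast
    then show "h y \<in> carrier H" using h H.weval_closed[OF H(2)] by simp
    fix z assume "z \<in> carrier G"
    then obtain v where v: "z = weval G s v" "v \<in> words X" using surj by blast
    show "h (y \<otimes>\<^bsub>G\<^esub> z) = h y \<otimes>\<^bsub>H\<^esub> h z"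
      using u v h[of "u @ v"] by (simp add: h G.weval_append[OF s] H.weval_append[OF H(2)])
  qed
  moreover have "h (s x) = t x" if "x \<in> X" for x
  proof -
    have "s x \<in> carrier G" "t x \<in> carrier H" using that s H(2) by auto
    then show ?thesis using h[of "[(x, True)]"] that by (simp add: weval_Cons)
  qed
  ultimately show thesis
    by (intro that[of h] group_hom.intro group_hom_axioms.intro G.is_group H.is_group)
qed


section \<open>Nilpotency class two\<close>

definition gcomm :: "('a, 'b) monoid_scheme \<Rightarrow> 'a \<Rightarrow> 'a \<Rightarrow> 'a" where
  "gcomm G x y = x \<otimes>\<^bsub>G\<^esub> y \<otimes>\<^bsub>G\<^esub> inv\<^bsub>G\<^esub> x \<otimes>\<^bsub>G\<^esub> inv\<^bsub>G\<^esub> y"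

text \<open>Nilpotency class at most two, in the form in which it is used for calculation.\<close>

definition class_two :: "('a, 'b) monoid_scheme \<Rightarrow> bool" where
  "class_two G \<longleftrightarrow>
     (\<forall>x\<in>carrier G. \<forall>y\<in>carrier G. \<forall>z\<in>carrier G. gcomm G x y \<otimes>\<^bsub>G\<^esub> z = z \<otimes>\<^bsub>G\<^esub> gcomm G x y)"

lemma commutator_subgroup_gcomm:
  "commutator_subgroup G H K = generate G {gcomm G x y | x y. x \<in> H \<and> y \<in> K}"
  by (simp add: commutator_subgroup_def gcomm_def)

lemma lower_central_2:
  "lower_central G 2 = generate G {gcomm G x y | x y. x \<in> carrier G \<and> y \<in> carrier G}"
  unfolding numeral_2_eq_2 lower_central.simps by (rule commutator_subgroup_gcomm)

lemma lower_central_3: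
  "lower_central G 3 = generate G {gcomm G x y | x y. x \<in> carrier G \<and> y \<in> lower_central G 2}"
  unfolding numeral_2_eq_2 numeral_3_eq_3 lower_central.simps(3)[of G "Suc 0"]
  by (rule commutator_subgroup_gcomm)

definition group_center :: "('a, 'b) monoid_scheme \<Rightarrow> 'a set" where
  "group_center G = {c \<in> carrier G. \<forall>z\<in>carrier G. c \<otimes>\<^bsub>G\<^esub> z = z \<otimes>\<^bsub>G\<^esub> c}"

lemma group_centerI:
  "c \<in> carrier G \<Longrightarrow> (\<And>z. z \<in> carrier G \<Longrightarrow> c \<otimes>\<^bsub>G\<^esub> z = z \<otimes>\<^bsub>G\<^esub> c) \<Longrightarrow> c \<in> group_center G"
  unfolding group_center_def by blast

lemma group_center_carrier: "c \<in> group_center G \<Longrightarrow> c \<in> carrier G"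
  unfolding group_center_def by blast

lemma group_center_commute:
  "c \<in> group_center G \<Longrightarrow> z \<in> carrier G \<Longrightarrow> c \<otimes>\<^bsub>G\<^esub> z = z \<otimes>\<^bsub>G\<^esub> c"
  unfolding group_center_def by blast

lemma (in group) subgroup_group_center: "subgroup (group_center G) G"
proof (rule subgroupI)
  show "group_center G \<subseteq> carrier G"
    by (auto intro: group_center_carrier)
  have "\<one> \<in> group_center G"
    by (simp add: group_center_def)
  then show "group_center G \<noteq> {}" by blast
  fix c assume c: "c \<in> group_center G"
  then have cG: "c \<in> carrier G" by (rule group_center_carrier)
  show "inv c \<in> group_center G"
  proof (rule group_centerI)
    fix z assume z: "z \<in> carrier G"
    have "inv c \<otimes> z \<otimes> c = inv c \<otimes> (c \<otimes> z)"
      using cG z by (simp add: m_assoc group_center_commute[OF c z])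
    also have "\<dots> = z"
      using cG z by (simp flip: m_assoc)
    finally show "inv c \<otimes> z = z \<otimes> inv c"
      using cG z by (metis inv_closed inv_solve_right m_closed)
  qed (use cG in simp)
  fix d assume d: "d \<in> group_center G"
  then have dG: "d \<in> carrier G" by (rule group_center_carrier)
  show "c \<otimes> d \<in> group_center G"
  proof (rule group_centerI)
    fix z assume z: "z \<in> carrier G"
    show "c \<otimes> d \<otimes> z = z \<otimes> (c \<otimes> d)"
      using cG dG z group_center_commute[OF c z] group_center_commute[OF d z] by (metis m_assoc)
  qed (use cG dG in simp)
qed

section \<open>Commutator calculus\<close>

context group
begin

lemma gcomm_closed [simp]:
  "x \<in> carrier G \<Longrightarrow> y \<in> carrier G \<Longrightarrow> gcomm G x y \<in> carrier G"
  by (simp add: gcomm_def)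

text \<open>The form \<open>xy = z(yx)\<close> contains no inverses and is convenient for rewriting;
  commutator relations are mostly handled in this shape below.\<close>

lemma gcomm_eq_iff:
  assumes "x \<in> carrier G" "y \<in> carrier G" "z \<in> carrier G"
  shows "gcomm G x y = z \<longleftrightarrow> x \<otimes> y = z \<otimes> (y \<otimes> x)"
proof -
  have "gcomm G x y = x \<otimes> y \<otimes> inv (y \<otimes> x)"
    using assms by (simp add: gcomm_def inv_mult_group m_assoc)
  then show ?thesis
    using assms inv_solve_right'[of z "x \<otimes> y" "y \<otimes> x"] by auto
qed

lemma gcomm_eq_one_iff:
  assumes "x \<in> carrier G" "y \<in> carrier G"
  shows "gcomm G x y = \<one> \<longleftrightarrow> x \<otimes> y = y \<otimes> x"
  using assms by (simp add: gcomm_eq_iff)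

lemma conj_gcomm:
  assumes "g \<in> carrier G" "x \<in> carrier G" "y \<in> carrier G"
  shows "g \<otimes> gcomm G x y \<otimes> inv g = gcomm G (g \<otimes> x \<otimes> inv g) (g \<otimes> y \<otimes> inv g)"
proof -
  have "inv g \<otimes> (g \<otimes> z) = z" if "z \<in> carrier G" for z
    using assms(1) that by (simp flip: m_assoc)
  then show ?thesis
    using assms by (simp add: gcomm_def inv_mult_group m_assoc)
qed

text \<open>By \<open>conj_gcomm\<close> a conjugate of a commutator is the commutator of the
  conjugates, so already the generating set is closed under conjugation.\<close>

lemma normal_commutator_subgroup:
  assumes "H \<lhd> G" "K \<lhd> G"
  shows "commutator_subgroup G H K \<lhd> G"
proof -
  interpret H: normal H G by fact
  interpret K: normal K G by fact
  show ?thesis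
    unfolding commutator_subgroup_gcomm
  proof (rule normal_generateI)
    fix c g assume "c \<in> {gcomm G x y | x y. x \<in> H \<and> y \<in> K}" and g: "g \<in> carrier G"
    then obtain x y where "c = gcomm G x y" "x \<in> H" "y \<in> K" by auto
    with g show "g \<otimes> c \<otimes> inv g \<in> {gcomm G x y | x y. x \<in> H \<and> y \<in> K}"
      using H.inv_op_closed2[OF g] K.inv_op_closed2[OF g] by (auto simp: conj_gcomm)
  qed (use H.subset K.subset in auto)
qed

lemma normal_lower_central: "lower_central G i \<lhd> G"
  proof (induction i rule: induct_nat_012)
  case (ge2 i)
  then show ?case by (simp add: normal_self normal_commutator_subgroup)
qed (simp_all add: normal_self)

lemma class_two_iff:
  "class_two G \<longleftrightarrow>
     (\<forall>x\<in>carrier G. \<forall>y\<in>carrier G. \<forall>z\<in>carrier G. gcomm G x (gcomm G y z) = \<one>)"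
  proof -
  have "gcomm G x (gcomm G y z) = \<one> \<longleftrightarrow> gcomm G y z \<otimes> x = x \<otimes> gcomm G y z"
    if "x \<in> carrier G" "y \<in> carrier G" "z \<in> carrier G" for x y z
    using that by (auto simp: gcomm_eq_one_iff)
  then show ?thesis
    unfolding class_two_def by blast
qed

lemma lower_central_3_generators:
  assumes "x \<in> carrier G" "y \<in> carrier G" "z \<in> carrier G"
  shows "gcomm G x (gcomm G y z) \<in> lower_central G 3"
proof -
  have "gcomm G y z \<in> lower_central G 2"
    using assms unfolding lower_central_2 by (blast intro: generate.incl)
  then show ?thesis
    using assms(1) unfolding lower_central_3 by (blast intro: generate.incl)
qed

lemma class_two_iff_center:
  "class_two G \<longleftrightarrow> (\<forall>x\<in>carrier G. \<forall>y\<in>carrier G. gcomm G x y \<in> group_center G)"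
  unfolding class_two_def using gcomm_closed
  by (meson group_centerI group_center_commute)

lemma gcomm_swap:
  assumes "x \<in> carrier G" "y \<in> carrier G"
  shows "gcomm G y x = inv (gcomm G x y)"
  using assms by (simp add: gcomm_def inv_mult_group m_assoc)

text \<open>In every group \<open>[x, yz] = [x, y] y [x, z] y^-1\<close>. Centrality is demanded of
  this single commutator only, so that the rule is available while class two is still being
  proved.\<close>

lemma gcomm_m_right:
  assumes x: "x \<in> carrier G" "y \<in> carrier G" "z \<in> carrier G"
    and c: "gcomm G x z \<in> group_center G"
  shows "gcomm G x (y \<otimes> z) = gcomm G x y \<otimes> gcomm G x z"
proof -
  have inv_c: "inv a \<otimes> (a \<otimes> b) = b" if "a \<in> carrier G" "b \<in> carrier G" for a b
    using that by (simp flip: m_assoc)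
  have "gcomm G x (y \<otimes> z) = gcomm G x y \<otimes> (y \<otimes> gcomm G x z) \<otimes> inv y"
    using x unfolding gcomm_def by (simp add: inv_c inv_mult_group m_assoc)
  also have "y \<otimes> gcomm G x z = gcomm G x z \<otimes> y"
    using group_center_commute[OF c, of y] x by simp
  finally show ?thesis
    using x by (simp add: m_assoc)
qed

lemma gcomm_inv_right:
  assumes x: "x \<in> carrier G" "y \<in> carrier G" and c: "gcomm G x y \<in> group_center G"
  shows "gcomm G x (inv y) = inv (gcomm G x y)"
proof -
  have "gcomm G x (inv y) \<otimes> gcomm G x y = gcomm G x (inv y \<otimes> y)"
    using x by (intro gcomm_m_right[symmetric] c) simp_all
  also have "\<dots> = \<one>"
    using x by (simp add: gcomm_def)
  finally show ?thesis
    using x by (simp add: inv_equality)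
qed

text \<open>For fixed \<open>x\<close> the elements whose commutator with \<open>x\<close> is
  central form a subgroup \<open>T x\<close>. For a generator \<open>x\<close> it contains
  \<open>S\<close>, hence everything; by antisymmetry \<open>S\<close> then lies in
  \<open>T x\<close> for every \<open>x\<close>, and a second application of the subgroup argument
  finishes.\<close>

lemma class_twoI_generators:
  assumes S: "S \<subseteq> carrier G" "generate G S = carrier G"
    and comm: "\<And>x y. x \<in> S \<Longrightarrow> y \<in> S \<Longrightarrow> gcomm G x y \<in> group_center G"
  shows "class_two G"
proof -
  interpret C: subgroup "group_center G" G by (rule subgroup_group_center)
  define T where "T x = {y \<in> carrier G. gcomm G x y \<in> group_center G}" for x
  have sub: "subgroup (T x) G" if x: "x \<in> carrier G" for x
  proof (rule subgroupI)
    have "gcomm G x \<one> = \<one>" using x by (simp add: gcomm_def)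
    then have "\<one> \<in> T x" by (simp add: T_def)
    then show "T x \<noteq> {}" by blast
  qed (use x in \<open>auto simp: T_def gcomm_inv_right gcomm_m_right\<close>)
  have swap: "y \<in> T x" if "x \<in> T y" "y \<in> carrier G" for x y
    using that by (auto simp: T_def gcomm_swap[of y x])
  have T_all: "carrier G \<subseteq> T x" if "x \<in> carrier G" "S \<subseteq> T x" for x
    using generate_subgroup_incl[OF that(2) sub[OF that(1)]] S(2) by simp
  have "S \<subseteq> T x" if "x \<in> S" for x
    using comm that S(1) by (auto simp: T_def)
  then have "y \<in> T x" if "x \<in> S" "y \<in> carrier G" for x y
    using T_all that S(1) by blast
  then have "S \<subseteq> T x" if "x \<in> carrier G" for x
    using swap that S(1) by blast
  then have "carrier G \<subseteq> T x" if "x \<in> carrier G" for x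
    using T_all that by blast
  then show ?thesis
    by (auto simp: class_two_iff_center T_def)
qed

end

lemma (in group_hom) hom_gcomm:
  assumes "x \<in> carrier G" "y \<in> carrier G"
  shows "h (gcomm G x y) = gcomm H (h x) (h y)"
  using assms by (simp add: gcomm_def)

text \<open>Commutators of \<open>G\<close> go to commutators of \<open>H\<close>, which are
  central. So the preimage \<open>?D\<close> of the center contains the second term of the series,
  and a commutator with an element of \<open>?D\<close> is sent to the identity.\<close>

lemma (in group_hom) lower_central_3_kernel:
  assumes "class_two H" "c \<in> lower_central G 3"
  shows "h c = \<one>\<^bsub>H\<^esub>"
proof -
  let ?D = "{d \<in> carrier G. h d \<in> group_center H}"
  interpret C: subgroup "group_center H" H by (rule H.subgroup_group_center)
  have "subgroup ?D G"
  proof (rule G.subgroupI)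
    have "\<one>\<^bsub>G\<^esub> \<in> ?D" by simp
    then show "?D \<noteq> {}" by blast
  qed auto
  moreover have "{gcomm G x y | x y. x \<in> carrier G \<and> y \<in> carrier G} \<subseteq> ?D"
    using assms(1) by (auto simp: hom_gcomm H.class_two_iff_center)
  ultimately have two: "lower_central G 2 \<subseteq> ?D"
    using G.generate_subgroup_incl unfolding lower_central_2 by blast
  have "{gcomm G x y | x y. x \<in> carrier G \<and> y \<in> lower_central G 2} \<subseteq> kernel G H h"
  proof clarify
    fix x y assume x: "x \<in> carrier G" and "y \<in> lower_central G 2"
    then have y: "y \<in> carrier G" "h y \<in> group_center H" using two by auto
    then have "gcomm H (h x) (h y) = \<one>\<^bsub>H\<^esub>"
      using x group_center_commute[of "h y" H "h x"] by (simp add: H.gcomm_eq_one_iff)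
    then show "gcomm G x y \<in> kernel G H h"
      using x y by (simp add: kernel_def hom_gcomm)
  qed
  then have "lower_central G 3 \<subseteq> kernel G H h"
    unfolding lower_central_3 using G.generate_subgroup_incl[OF _ subgroup_kernel] by blast
  then show ?thesis
    using assms(2) by (auto simp: kernel_def)
qed

context group
begin

text \<open>A triple commutator of cosets is the coset of a triple commutator, and the latter is one
  of the generators of the subgroup divided out.\<close>

lemma class_two_FactGroup: "class_two (G Mod lower_central G 3)"
proof -
  let ?N = "lower_central G 3"
  interpret normal ?N G by (rule normal_lower_central)
  interpret Q: group "G Mod ?N" by (rule factorgroup_is_group)
  interpret \<pi>: group_hom G "G Mod ?N" "\<lambda>x. ?N #> x"
    by (intro group_hom.intro group_hom_axioms.intro r_coset_hom_Mod is_group Q.is_group)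
  have "gcomm (G Mod ?N) (?N #> x) (gcomm (G Mod ?N) (?N #> y) (?N #> z)) = \<one>\<^bsub>G Mod ?N\<^esub>"
    if "x \<in> carrier G" "y \<in> carrier G" "z \<in> carrier G" for x y z
  proof -
    have "?N #> gcomm G x (gcomm G y z) = ?N"
      using that by (intro coset_join2 lower_central_3_generators subgroup_axioms) auto
    then show ?thesis
      using that by (simp only: \<pi>.hom_gcomm[symmetric] gcomm_closed one_FactGroup)
  qed
  then show ?thesis
    unfolding Q.class_two_iff carrier_FactGroup by blast
qed

lemma conj_commute:
  assumes "x \<in> carrier G" "y \<in> carrier G" "x \<otimes> y = y \<otimes> x"
  shows "x \<otimes> y \<otimes> inv x = y" "inv x \<otimes> y \<otimes> x = y"
proof -
  show "x \<otimes> y \<otimes> inv x = y"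
    using assms by (simp add: inv_solve_right')
  have "inv x \<otimes> y \<otimes> x = inv x \<otimes> (x \<otimes> y)"
    using assms by (simp add: m_assoc)
  then show "inv x \<otimes> y \<otimes> x = y"
    using assms(1,2) by (simp flip: m_assoc)
qed

lemma gcomm_inv_inv_commute:
  assumes "x \<in> carrier G" "y \<in> carrier G" "x \<otimes> y = y \<otimes> x"
  shows "gcomm G (inv x) (inv y) = \<one>"
proof -
  have "inv x \<otimes> inv y = inv (x \<otimes> y)"
    using assms by (simp add: inv_mult_group)
  then show ?thesis
    using assms(1,2) by (simp add: gcomm_eq_one_iff inv_mult_group)
qed

text \<open>With products nested to the right, this is how commuting factors are exchanged inside a
  longer product.\<close>

lemma commute_m_left:
  assumes "x \<in> carrier G" "y \<in> carrier G" "z \<in> carrier G" "x \<otimes> y = y \<otimes> x"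
  shows "x \<otimes> (y \<otimes> z) = y \<otimes> (x \<otimes> z)"
  using assms by (metis m_assoc)

lemma group_centerI_generators:
  assumes S: "S \<subseteq> carrier G" "generate G S = carrier G"
    and c: "c \<in> carrier G" "\<And>x. x \<in> S \<Longrightarrow> c \<otimes> x = x \<otimes> c"
  shows "c \<in> group_center G"
proof -
  \<comment> \<open>The centralizer of \<open>c\<close>, written with trivial commutators: these are
    central, so \<open>gcomm_inv_right\<close> and \<open>gcomm_m_right\<close> apply.\<close>
  define T where "T = {x \<in> carrier G. gcomm G c x = \<one>}"
  have "subgroup T G"
  proof (rule subgroupI)
    have "\<one> \<in> T" using c by (simp add: T_def gcomm_def)
    then show "T \<noteq> {}" by blast
    interpret C: subgroup "group_center G" G by (rule subgroup_group_center)
    fix x assume x: "x \<in> T"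
    then show "inv x \<in> T"
      using c(1) by (auto simp: T_def gcomm_inv_right)
    fix y assume "y \<in> T"
    with x show "x \<otimes> y \<in> T"
      using c(1) by (auto simp: T_def gcomm_m_right)
  qed (simp add: T_def)
  moreover have "x \<in> T" if "x \<in> S" for x
    using S(1) c that gcomm_eq_one_iff[of c x] by (auto simp: T_def)
  ultimately have "carrier G \<subseteq> T"
    using generate_subgroup_incl[of S T] S(2) by blast
  then have "c \<otimes> z = z \<otimes> c" if "z \<in> carrier G" for z
    using that c(1) gcomm_eq_one_iff[of c z] by (auto simp: T_def)
  then show ?thesis
    using c(1) by (intro group_centerI)
qed

text \<open>Write \<open>xy = c yx\<close> with \<open>c\<close> central. Then
  \<open>xyx = c yxx\<close> and \<open>yxy = c yyx\<close>, and cancelling \<open>c\<close>,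
  \<open>y\<close> and the last \<open>x\<close> leaves \<open>x = y\<close>.\<close>

lemma class_two_braid_imp_eq:
  assumes "class_two G" "x \<in> carrier G" "y \<in> carrier G"
    and "x \<otimes> (y \<otimes> x) = y \<otimes> (x \<otimes> y)"
  shows "x = y"
proof -
  define c where "c = gcomm G x y"
  have c: "c \<in> group_center G" "c \<in> carrier G"
    using assms(1-3) by (auto simp: class_two_iff_center c_def)
  have xy: "x \<otimes> y = c \<otimes> (y \<otimes> x)"
    using assms gcomm_eq_iff[of x y c] c by (simp add: c_def)
  have "c \<otimes> (y \<otimes> x) \<otimes> x = x \<otimes> (y \<otimes> x)"
    using assms(2,3) by (simp add: m_assoc flip: xy)
  also have "\<dots> = y \<otimes> (c \<otimes> (y \<otimes> x))"
    by (simp only: assms(4) xy)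
  also have "\<dots> = c \<otimes> (y \<otimes> (y \<otimes> x))"
    using assms(2,3) c group_center_commute[OF c(1) assms(3)] by (intro commute_m_left) auto
  finally have "y \<otimes> (x \<otimes> x) = y \<otimes> (y \<otimes> x)"
    using assms(2,3) c by (simp add: m_assoc)
  then show ?thesis
    using assms(2,3) by simp
qed

section \<open>Evaluation of compound words\<close>

lemma weval_letter:
  "s x \<in> carrier G \<Longrightarrow> weval G s [(x, True)] = s x"
  by (simp add: weval_Cons)

text \<open>The alphabet is taken to be all letters with value in the carrier. Thus the side
  conditions reduce to closure of the single letters and no ambient set of generators has to be
  supplied to the simplifier.\<close>

lemma weval_append_closed:
  assumes "u \<in> words {x. s x \<in> carrier G}" "v \<in> words {x. s x \<in> carrier G}"
  shows "weval G s (u @ v) = weval G s u \<otimes> weval G s v"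
  using assms by (intro weval_append) auto

lemma weval_winv_closed:
  assumes "u \<in> words {x. s x \<in> carrier G}"
  shows "weval G s (winv u) = inv (weval G s u)"
  using assms by (intro weval_winv) auto

lemma weval_in_carrier:
  assumes "u \<in> words {x. s x \<in> carrier G}"
  shows "weval G s u \<in> carrier G"
  using assms by (intro weval_closed) auto

lemma weval_wcomm:
  assumes "u \<in> words {x. s x \<in> carrier G}" "v \<in> words {x. s x \<in> carrier G}"
  shows "weval G s (wcomm u v) = gcomm G (weval G s u) (weval G s v)"
  using assms by (simp add: wcomm_def gcomm_def weval_append_closed weval_winv_closed weval_in_carrier m_assoc)

lemma weval_wpow:
  assumes "u \<in> words {x. s x \<in> carrier G}" "v \<in> words {x. s x \<in> carrier G}"
  shows "weval G s (wpow u v) = inv (weval G s v) \<otimes> weval G s u \<otimes> weval G s v"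
  using assms by (simp add: wpow_def weval_append_closed weval_winv_closed weval_in_carrier m_assoc)

lemma weval_wconj:
  assumes "u \<in> words {x. s x \<in> carrier G}" "v \<in> words {x. s x \<in> carrier G}"
  shows "weval G s (wconj u v) = weval G s u \<otimes> weval G s v \<otimes> inv (weval G s u)"
  using assms by (simp add: wconj_def weval_append_closed weval_winv_closed weval_in_carrier m_assoc)

lemmas weval_simps = weval_letter weval_append_closed weval_winv_closed weval_wcomm weval_wpow
  weval_wconj weval_in_carrier

end

lemma words_wcomm: "u \<in> words X \<Longrightarrow> v \<in> words X \<Longrightarrow> wcomm u v \<in> words X"
  by (simp add: wcomm_def)

text \<open>The relation sets are unions of comprehensions with one to five bound variables; each
  arity needs its own equivalence.\<close>

lemma satisfies_Collect:
  "satisfies G s {F1 i | i. P1 i} \<longleftrightarrow>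
     (\<forall>i. P1 i \<longrightarrow> weval G s (fst (F1 i)) = weval G s (snd (F1 i)))"
  "satisfies G s {F2 i j | i j. P2 i j} \<longleftrightarrow>
     (\<forall>i j. P2 i j \<longrightarrow> weval G s (fst (F2 i j)) = weval G s (snd (F2 i j)))"
  "satisfies G s {F3 i j k | i j k. P3 i j k} \<longleftrightarrow>
     (\<forall>i j k. P3 i j k \<longrightarrow> weval G s (fst (F3 i j k)) = weval G s (snd (F3 i j k)))"
  "satisfies G s {F4 i j k l | i j k l. P4 i j k l} \<longleftrightarrow>
     (\<forall>i j k l. P4 i j k l \<longrightarrow> weval G s (fst (F4 i j k l)) = weval G s (snd (F4 i j k l)))"
  "satisfies G s {F5 i j k l m | i j k l m. P5 i j k l m} \<longleftrightarrow>
     (\<forall>i j k l m. P5 i j k l m \<longrightarrow> weval G s (fst (F5 i j k l m)) = weval G s (snd (F5 i j k l m)))"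
  unfolding satisfies_def case_prod_beta by blast+

lemmas satisfies_unfold = satisfies_Un satisfies_Collect wcommute_def fst_conv snd_conv

section \<open>Collapsing the braid relations\<close>

text \<open>Names are kept as parameters so that one proof serves both the plain and the tilde
  generators. As \<sigma> commutes with all \<open>a i\<close> and \<open>b i\<close>, conjugation
  by it is invisible, and in \<open>r5\<close> collecting its powers in front leaves the assumed
  formula for \<open>a i\<close> and \<open>b i\<close>.\<close>

lemma (in group) satisfies_surface_braid_relsI:
  assumes \<sigma>: "\<sigma> \<in> carrier G" "\<And>i. i \<in> {1..<m} \<Longrightarrow> t (s i) = \<sigma>"
    and ab: "\<And>i. i \<in> {1..g} \<Longrightarrow> t (a i) \<in> carrier G" "\<And>i. i \<in> {1..g} \<Longrightarrow> t (b i) \<in> carrier G"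
    and comm: "\<And>i. i \<in> {1..g} \<Longrightarrow> t (a i) \<otimes> \<sigma> = \<sigma> \<otimes> t (a i)"
      "\<And>i. i \<in> {1..g} \<Longrightarrow> t (b i) \<otimes> \<sigma> = \<sigma> \<otimes> t (b i)"
    and ab_comm: "\<And>i. i \<in> {1..g} \<Longrightarrow> t (a i) \<otimes> t (b i) = \<sigma> \<otimes> \<sigma> \<otimes> (t (b i) \<otimes> t (a i))"
    and cd: "\<And>i j c d. i \<in> {1..g} \<Longrightarrow> j \<in> {1..g} \<Longrightarrow> i < j \<Longrightarrow> c \<in> {a i, b i} \<Longrightarrow> d \<in> {a j, b j} \<Longrightarrow>
      t c \<otimes> t d = t d \<otimes> t c"
  shows "satisfies G t (surface_braid_rels m g s a b)"
proof -
  have c: "t c \<in> carrier G" "t c \<otimes> \<sigma> = \<sigma> \<otimes> t c" if "c \<in> a ` {1..g} \<union> b ` {1..g}" for c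
    using that ab comm by auto
  have r4: "t c \<otimes> (\<sigma> \<otimes> (t c \<otimes> \<sigma>)) = \<sigma> \<otimes> (t c \<otimes> (\<sigma> \<otimes> t c))" if "c \<in> a ` {1..g} \<union> b ` {1..g}" for c
    using c[OF that] \<sigma>(1) commute_m_left[of "t c" \<sigma> "\<sigma> \<otimes> t c"] by simp
  have r5: "t (a i) \<otimes> (\<sigma> \<otimes> t (b i)) = \<sigma> \<otimes> (t (b i) \<otimes> (\<sigma> \<otimes> (t (a i) \<otimes> \<sigma>)))" if "i \<in> {1..g}" for i
  proof -
    have "t (a i) \<otimes> (\<sigma> \<otimes> t (b i)) = \<sigma> \<otimes> (\<sigma> \<otimes> (\<sigma> \<otimes> (t (b i) \<otimes> t (a i))))"
      using that \<sigma>(1) ab[OF that] comm[OF that] ab_comm[OF that] by (simp add: commute_m_left m_assoc)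
    also have "\<dots> = \<sigma> \<otimes> (t (b i) \<otimes> (\<sigma> \<otimes> (t (a i) \<otimes> \<sigma>)))"
      using that \<sigma>(1) ab[OF that] comm[OF that]
        commute_m_left[of "t (b i)" \<sigma>] by simp
    finally show ?thesis .
  qed
  have r6: "inv \<sigma> \<otimes> (t c \<otimes> \<sigma>) \<otimes> t d = t d \<otimes> (inv \<sigma> \<otimes> (t c \<otimes> \<sigma>))"
    if "i \<in> {1..g}" "j \<in> {1..g}" "i < j" "c \<in> {a i, b i}" "d \<in> {a j, b j}" for c d i j
  proof -
    have "c \<in> a ` {1..g} \<union> b ` {1..g}" using that by auto
    from c[OF this] have "inv \<sigma> \<otimes> (t c \<otimes> \<sigma>) = t c"
      using \<sigma>(1) conj_commute(2)[of \<sigma> "t c"] by (simp add: m_assoc)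
    then show ?thesis using cd[OF that] by simp
  qed
  show ?thesis
    unfolding surface_braid_rels_def satisfies_Un
  proof (intro conjI)
    show "satisfies G t {(\<langle>c\<rangle> @ \<langle>s 1\<rangle> @ \<langle>c\<rangle> @ \<langle>s 1\<rangle>, \<langle>s 1\<rangle> @ \<langle>c\<rangle> @ \<langle>s 1\<rangle> @ \<langle>c\<rangle>) | c.
        1 < m \<and> c \<in> a ` {1..g} \<union> b ` {1..g}}"
      unfolding satisfies_unfold using \<sigma> c r4 by (simp add: weval_Cons)
    show "satisfies G t {(\<langle>a i\<rangle> @ \<langle>s 1\<rangle> @ \<langle>b i\<rangle>, \<langle>s 1\<rangle> @ \<langle>b i\<rangle> @ \<langle>s 1\<rangle> @ \<langle>a i\<rangle> @ \<langle>s 1\<rangle>) | i.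
        1 < m \<and> i \<in> {1..g}}"
      unfolding satisfies_unfold using \<sigma> ab r5 by (simp add: weval_Cons)
    show "satisfies G t {wcommute \<langle>c\<rangle> \<langle>s i\<rangle> | c i.
        i \<in> {1..<m} \<and> i \<noteq> 1 \<and> c \<in> a ` {1..g} \<union> b ` {1..g}}"
      using \<sigma> c unfolding satisfies_def wcommute_def by (clarsimp simp: weval_Cons)
    show "satisfies G t {wcommute (winv \<langle>s 1\<rangle> @ \<langle>c\<rangle> @ \<langle>s 1\<rangle>) \<langle>d\<rangle> | c d i j.
        1 < m \<and> i \<in> {1..g} \<and> j \<in> {1..g} \<and> i < j \<and> c \<in> {a i, b i} \<and> d \<in> {a j, b j}}"
      unfolding satisfies_def
    proof clarify
      fix u v c d i j
      assume uv: "(u, v) = wcommute (winv \<langle>s 1\<rangle> @ \<langle>c\<rangle> @ \<langle>s 1\<rangle>) \<langle>d\<rangle>"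
        and that: "1 < m" "i \<in> {1..g}" "j \<in> {1..g}" "i < j" "c \<in> {a i, b i}" "d \<in> {a j, b j}"
      then have "t c \<in> carrier G" "t d \<in> carrier G" "t (s 1) = \<sigma>" using c \<sigma> by auto
      then show "weval G t u = weval G t v"
        using uv r6[OF that(2-)] \<sigma>(1) by (simp add: wcommute_def weval_Cons winv_Cons m_assoc)
    qed
  \<comment> \<open>Left over are the two families among the \<open>s i\<close> alone, where both
    sides are the same power of \<sigma>.\<close>
  qed (use \<sigma> in \<open>auto simp: satisfies_def wcommute_def weval_Cons\<close>)
qed

text \<open>Braid relations identify the \<open>s i\<close>. Then \<open>s 1\<close> inherits from
  \<open>s 2\<close> that it commutes with the letters \<open>a i\<close> and \<open>b i\<close>,
  and this simplifies all relations in which \<open>s 1\<close> meets two such letters.\<close>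

lemma (in group) satisfies_surface_braid_relsD:
  assumes two: "class_two G" and m: "m \<ge> 3" and sat: "satisfies G t (surface_braid_rels m g s a b)"
    and carr: "t ` s ` {1..<m} \<subseteq> carrier G" "t ` a ` {1..g} \<subseteq> carrier G" "t ` b ` {1..g} \<subseteq> carrier G"
  shows "i \<in> {1..<m} \<Longrightarrow> t (s i) = t (s 1)"
    and "c \<in> a ` {1..g} \<union> b ` {1..g} \<Longrightarrow> t c \<otimes> t (s 1) = t (s 1) \<otimes> t c"
    and "i \<in> {1..g} \<Longrightarrow> t (a i) \<otimes> t (b i) = t (s 1) \<otimes> t (s 1) \<otimes> (t (b i) \<otimes> t (a i))"
    and "i \<in> {1..g} \<Longrightarrow> j \<in> {1..g} \<Longrightarrow> i \<noteq> j \<Longrightarrow> c \<in> {a i, b i} \<Longrightarrow> d \<in> {a j, b j} \<Longrightarrow>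
      t c \<otimes> t d = t d \<otimes> t c"
proof -
  have s: "\<And>i. i \<in> {1..<m} \<Longrightarrow> t (s i) \<in> carrier G"
    and ab: "\<And>i. i \<in> {1..g} \<Longrightarrow> t (a i) \<in> carrier G" "\<And>i. i \<in> {1..g} \<Longrightarrow> t (b i) \<in> carrier G"
    using carr by auto
  note raw = sat[unfolded surface_braid_rels_def satisfies_unfold]
  \<comment> \<open>In this order: the braid relations, commutation of letters with
    \<open>s i\<close> for \<open>i \<noteq> 1\<close>, the relation between \<open>a i\<close> and
    \<open>b i\<close>, and the relations for \<open>i < j\<close>.\<close>
  note rels = raw[THEN conjunct1, THEN conjunct1, THEN conjunct1, THEN conjunct1, THEN conjunct2]
    raw[THEN conjunct1, THEN conjunct1, THEN conjunct1, THEN conjunct2]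
    raw[THEN conjunct1, THEN conjunct2] raw[THEN conjunct2]
  have s_eq: "t (s i) = t (s 1)" if "i \<in> {1..<m}" for i
  proof -
    have "i \<ge> 1" "i < m" using that by auto
    then show ?thesis
    proof (induction i rule: dec_induct)
      case (step i)
      have si: "t (s i) \<in> carrier G" "t (s (Suc i)) \<in> carrier G"
        using step s by auto
      have "t (s i) = t (s (Suc i))"
        by (rule class_two_braid_imp_eq[OF two si]) (use rels(1)[rule_format, of i] si step in \<open>simp add: weval_Cons\<close>)
      then show ?case using step by simp
    qed simp
  qed
  then show "i \<in> {1..<m} \<Longrightarrow> t (s i) = t (s 1)" .
  \<comment> \<open>Here \<open>m \<ge> 3\<close> provides the index 2, to which the commutation
    relation for \<open>i \<noteq> 1\<close> applies.\<close>
  have s2: "t (s 2) = t (s 1)" and s1: "t (s 1) \<in> carrier G"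
    using s_eq[of 2] s[of 1] m by auto
  have comm: "t c \<otimes> t (s 1) = t (s 1) \<otimes> t c" if "c \<in> a ` {1..g} \<union> b ` {1..g}" for c
  proof -
    have "t c \<in> carrier G" using that ab by auto
    then show ?thesis
      using rels(2)[rule_format, of 2 c] that m s1 s2 by (simp add: weval_Cons)
  qed
  then show "c \<in> a ` {1..g} \<union> b ` {1..g} \<Longrightarrow> t c \<otimes> t (s 1) = t (s 1) \<otimes> t c" .
  show "t (a i) \<otimes> t (b i) = t (s 1) \<otimes> t (s 1) \<otimes> (t (b i) \<otimes> t (a i))" if "i \<in> {1..g}"
  proof -
    have eq: "t (a i) \<otimes> (t (s 1) \<otimes> t (b i)) = t (s 1) \<otimes> (t (b i) \<otimes> (t (s 1) \<otimes> (t (a i) \<otimes> t (s 1))))"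
      using rels(3)[rule_format, of i] that m s1 ab[OF that] by (simp add: weval_Cons)
    \<comment> \<open>Move every \<open>s 1\<close> to the front: one occurrence on the left, three
      on the right. Cancelling one leaves the square that appears in the commutator of
      \<open>a i\<close> and \<open>b i\<close>.\<close>
    have "t (s 1) \<otimes> (t (a i) \<otimes> t (b i)) = t (a i) \<otimes> (t (s 1) \<otimes> t (b i))"
      using that s1 ab[OF that] comm[of "a i"] by (intro commute_m_left) auto
    also have "\<dots> = t (s 1) \<otimes> (t (s 1) \<otimes> (t (s 1) \<otimes> (t (b i) \<otimes> t (a i))))"
      unfolding eq
      using that s1 ab[OF that] comm[of "a i"] comm[of "b i"] commute_m_left[of "t (b i)" "t (s 1)"]
      by simp
    finally show ?thesis
      using that s1 ab[OF that] by (simp add: m_assoc)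
  qed
  have lt: "t c \<otimes> t d = t d \<otimes> t c"
    if "i \<in> {1..g}" "j \<in> {1..g}" "i < j" "c \<in> {a i, b i}" "d \<in> {a j, b j}" for i j c d
  proof -
    have cd: "t c \<in> carrier G" "t d \<in> carrier G" using that ab by auto
    have "inv (t (s 1)) \<otimes> (t c \<otimes> (t (s 1) \<otimes> t d)) = t d \<otimes> (inv (t (s 1)) \<otimes> (t c \<otimes> t (s 1)))"
      using rels(4)[rule_format, of i j c d] that m s1 cd by (simp add: weval_Cons winv_Cons)
    then have "inv (t (s 1)) \<otimes> (t c \<otimes> t (s 1)) \<otimes> t d = t d \<otimes> (inv (t (s 1)) \<otimes> (t c \<otimes> t (s 1)))"
      using s1 cd by (simp add: m_assoc)
    moreover have "inv (t (s 1)) \<otimes> (t c \<otimes> t (s 1)) = t c"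
    proof -
      have "c \<in> a ` {1..g} \<union> b ` {1..g}" using that by auto
      then show ?thesis
        using conj_commute(2)[of "t (s 1)" "t c"] s1 cd comm[of c] by (simp add: m_assoc)
    qed
    ultimately show ?thesis by simp
  qed
  show "i \<in> {1..g} \<Longrightarrow> j \<in> {1..g} \<Longrightarrow> i \<noteq> j \<Longrightarrow> c \<in> {a i, b i} \<Longrightarrow> d \<in> {a j, b j} \<Longrightarrow>
      t c \<otimes> t d = t d \<otimes> t c"
    using lt[of i j c d] lt[of j i d c] by (metis linorder_neqE_nat)
qed

section \<open>Identification of the generators\<close>

fun collapse :: "bgen \<Rightarrow> qgen" where
  "collapse (Sig i) = QSig"
| "collapse (TSig i) = QTSig"
| "collapse (A i) = QA i"
| "collapse (B i) = QB i"
| "collapse (TA i) = QTA i"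
| "collapse (TB i) = QTB i"
| "collapse (Zeta i) = QZeta"

text \<open>A section of \<open>collapse\<close>. Index 1 exists in every family that gets collapsed
  as soon as k, n >= 2.\<close>

fun representative :: "qgen \<Rightarrow> bgen" where
  "representative QSig = Sig 1"
| "representative QTSig = TSig 1"
| "representative (QA i) = A i"
| "representative (QB i) = B i"
| "representative (QTA i) = TA i"
| "representative (QTB i) = TB i"
| "representative QZeta = Zeta 1"

lemmas gens_defs = gens_S_def gens_TS_def gens_AB_def gens_TAB_def gens_Z_def

lemma collapse_representative [simp]: "collapse (representative y) = y"
  by (cases y) simp_all

lemma representative_in_braid_gens:
  assumes "k \<ge> 2" "n \<ge> 2" "y \<in> quotient_gens g"
  shows "representative y \<in> braid_gens k n g"
  using assms by (auto simp: quotient_gens_def braid_gens_def gens_defs)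

lemma collapse_in_quotient_gens: "x \<in> braid_gens k n g \<Longrightarrow> collapse x \<in> quotient_gens g"
  by (auto simp: quotient_gens_def braid_gens_def gens_defs)

lemma (in group) commute_up_to:
  assumes "x \<in> carrier G" "y \<in> carrier G" "z \<in> carrier G" "x \<otimes> y = z \<otimes> (y \<otimes> x)"
  shows "x \<otimes> y \<otimes> inv x = z \<otimes> y" "y \<otimes> x \<otimes> inv y = inv z \<otimes> x"
proof -
  show "x \<otimes> y \<otimes> inv x = z \<otimes> y"
    using assms by (simp add: inv_solve_right' m_assoc)
  have "inv z \<otimes> (x \<otimes> y) = y \<otimes> x"
    using assms(1-3) unfolding assms(4) by (simp flip: m_assoc)
  then show "y \<otimes> x \<otimes> inv y = inv z \<otimes> x"
    using assms(1-3) inv_solve_right'[of "inv z \<otimes> x" "y \<otimes> x" y] by (simp add: m_assoc)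
qed

text \<open>The working form of the quotient relations, free of words and inverses.\<close>

lemma (in group) satisfies_quotient_rels_iff:
  assumes q: "q ` quotient_gens g \<subseteq> carrier G"
  shows "satisfies G q (quotient_rels g) \<longleftrightarrow>
    (\<forall>x\<in>quotient_gens g. \<forall>y\<in>quotient_gens g. x \<noteq> y \<and> {x, y} \<notin> noncommuting_pairs g \<longrightarrow>
       q x \<otimes> q y = q y \<otimes> q x) \<and>
    (\<forall>i\<in>{1..g}.
       q (QA i) \<otimes> q (QB i) = q QSig \<otimes> q QSig \<otimes> (q (QB i) \<otimes> q (QA i)) \<and>
       q (QTA i) \<otimes> q (QTB i) = q QTSig \<otimes> q QTSig \<otimes> (q (QTB i) \<otimes> q (QTA i)) \<and>
       q (QA i) \<otimes> q (QTB i) = q QZeta \<otimes> (q (QTB i) \<otimes> q (QA i)) \<and>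
       q (QTA i) \<otimes> q (QB i) = q QZeta \<otimes> (q (QB i) \<otimes> q (QTA i)))"
proof -
  have carr: "q x \<in> carrier G" if "x \<in> quotient_gens g" for x
    using that q by auto
  have c: "q QSig \<in> carrier G" "q QTSig \<in> carrier G" "q QZeta \<in> carrier G"
    "\<And>i. i \<in> {1..g} \<Longrightarrow> q (QA i) \<in> carrier G" "\<And>i. i \<in> {1..g} \<Longrightarrow> q (QB i) \<in> carrier G"
    "\<And>i. i \<in> {1..g} \<Longrightarrow> q (QTA i) \<in> carrier G" "\<And>i. i \<in> {1..g} \<Longrightarrow> q (QTB i) \<in> carrier G"
    by (auto intro!: carr simp: quotient_gens_def)
  have eq: "weval G q (wcomm \<langle>x\<rangle> \<langle>y\<rangle>) = z \<longleftrightarrow> q x \<otimes> q y = z \<otimes> (q y \<otimes> q x)"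
    if "q x \<in> carrier G" "q y \<in> carrier G" "z \<in> carrier G" for x y z
    using that by (simp add: weval_simps gcomm_eq_iff)
  have comm: "weval G q (\<langle>x\<rangle> @ \<langle>y\<rangle>) = weval G q (\<langle>y\<rangle> @ \<langle>x\<rangle>) \<longleftrightarrow> q x \<otimes> q y = q y \<otimes> q x"
    if "x \<in> quotient_gens g" "y \<in> quotient_gens g" for x y
    using that carr by (simp add: weval_Cons)
  have w: "weval G q (\<langle>QSig\<rangle> @ \<langle>QSig\<rangle>) = q QSig \<otimes> q QSig"
    "weval G q (\<langle>QTSig\<rangle> @ \<langle>QTSig\<rangle>) = q QTSig \<otimes> q QTSig" "weval G q \<langle>QZeta\<rangle> = q QZeta"
    using c by (simp_all add: weval_Cons)
  have e: "weval G q (wcomm \<langle>QA i\<rangle> \<langle>QB i\<rangle>) = weval G q (\<langle>QSig\<rangle> @ \<langle>QSig\<rangle>) \<longleftrightarrow>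
        q (QA i) \<otimes> q (QB i) = q QSig \<otimes> q QSig \<otimes> (q (QB i) \<otimes> q (QA i))"
    "weval G q (wcomm \<langle>QTA i\<rangle> \<langle>QTB i\<rangle>) = weval G q (\<langle>QTSig\<rangle> @ \<langle>QTSig\<rangle>) \<longleftrightarrow>
        q (QTA i) \<otimes> q (QTB i) = q QTSig \<otimes> q QTSig \<otimes> (q (QTB i) \<otimes> q (QTA i))"
    "weval G q (wcomm \<langle>QA i\<rangle> \<langle>QTB i\<rangle>) = weval G q \<langle>QZeta\<rangle> \<longleftrightarrow>
        q (QA i) \<otimes> q (QTB i) = q QZeta \<otimes> (q (QTB i) \<otimes> q (QA i))"
    "weval G q (wcomm \<langle>QTA i\<rangle> \<langle>QB i\<rangle>) = weval G q \<langle>QZeta\<rangle> \<longleftrightarrow>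
        q (QTA i) \<otimes> q (QB i) = q QZeta \<otimes> (q (QB i) \<otimes> q (QTA i))"
    if "i \<in> {1..g}" for i
    by (simp_all only: w eq c that m_closed)
  show ?thesis
    unfolding quotient_rels_def satisfies_unfold
    by (simp only: e comm Ball_def cong: imp_cong conj_cong) blast
qed

text \<open>The values \<sigma>, \<tau>, \<zeta> commute with all generators. Hence every
  conjugation by them drops out and each factor \<open>[x^-1, \<zeta>^-1]\<close> is trivial; what
  remains of a braid relation is a commutation or one of the four commutator formulas.\<close>

lemma (in group) satisfies_quotient_imp_braid_rels:
  assumes q: "q ` quotient_gens g \<subseteq> carrier G"
    and sat: "satisfies G q (quotient_rels g)"
  shows "satisfies G (q \<circ> collapse) (braid_rels k n g)"
proof -
  have carr: "q x \<in> carrier G" if "x \<in> quotient_gens g" for x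
    using that q by auto
  note rels = sat[unfolded satisfies_quotient_rels_iff[OF q]]
  have comm: "q x \<otimes> q y = q y \<otimes> q x"
    if "x \<in> quotient_gens g" "y \<in> quotient_gens g" "{x, y} \<notin> noncommuting_pairs g" for x y
    using that rels by (cases "x = y") blast+
  define \<sigma> \<tau> \<zeta> where "\<sigma> = q QSig" and "\<tau> = q QTSig" and "\<zeta> = q QZeta"
  have carrs: "\<sigma> \<in> carrier G" "\<tau> \<in> carrier G" "\<zeta> \<in> carrier G"
    "\<And>i. i \<in> {1..g} \<Longrightarrow> q (QA i) \<in> carrier G" "\<And>i. i \<in> {1..g} \<Longrightarrow> q (QB i) \<in> carrier G"
    "\<And>i. i \<in> {1..g} \<Longrightarrow> q (QTA i) \<in> carrier G" "\<And>i. i \<in> {1..g} \<Longrightarrow> q (QTB i) \<in> carrier G"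
    by (auto intro!: carr simp: quotient_gens_def \<sigma>_def \<tau>_def \<zeta>_def)
  have central: "q x \<otimes> \<sigma> = \<sigma> \<otimes> q x" "q x \<otimes> \<tau> = \<tau> \<otimes> q x" "q x \<otimes> \<zeta> = \<zeta> \<otimes> q x"
    if "x \<in> quotient_gens g" for x
    using that unfolding \<sigma>_def \<tau>_def \<zeta>_def
    by (auto intro!: comm simp: quotient_gens_def noncommuting_pairs_def doubleton_eq_iff)
  have apart: "q x \<otimes> q y = q y \<otimes> q x"
    if "i \<in> {1..g}" "j \<in> {1..g}" "i \<noteq> j" "x \<in> {QA i, QB i, QTA i, QTB i}" "y \<in> {QA j, QB j, QTA j, QTB j}"
    for x y i j
    using that by (auto intro!: comm simp: quotient_gens_def noncommuting_pairs_def doubleton_eq_iff)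
  have same: "q (QTA i) \<otimes> q (QA i) = q (QA i) \<otimes> q (QTA i)"
    "q (QTB i) \<otimes> q (QB i) = q (QB i) \<otimes> q (QTB i)" if "i \<in> {1..g}" for i
    using that by (auto intro!: comm simp: quotient_gens_def noncommuting_pairs_def doubleton_eq_iff)
  have main: "q (QA i) \<otimes> q (QB i) = \<sigma> \<otimes> \<sigma> \<otimes> (q (QB i) \<otimes> q (QA i))"
    "q (QTA i) \<otimes> q (QTB i) = \<tau> \<otimes> \<tau> \<otimes> (q (QTB i) \<otimes> q (QTA i))"
    "q (QA i) \<otimes> q (QTB i) = \<zeta> \<otimes> (q (QTB i) \<otimes> q (QA i))"
    "q (QTA i) \<otimes> q (QB i) = \<zeta> \<otimes> (q (QB i) \<otimes> q (QTA i))" if "i \<in> {1..g}" for i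
    using that rels unfolding \<sigma>_def \<tau>_def \<zeta>_def by blast+
  define t where "t = q \<circ> collapse"
  have t: "t x = q (collapse x)" for x
    by (simp add: t_def)
  have gen: "x \<in> quotient_gens g" if "i \<in> {1..g}" "x \<in> {QA i, QB i, QTA i, QTB i}" for i x
    using that by (auto simp: quotient_gens_def)
  have surf: "satisfies G t (surface_braid_rels k g Sig A B)"
  proof (rule satisfies_surface_braid_relsI[of \<sigma>])
    fix i j c d assume "i \<in> {1..g}" "j \<in> {1..g}" "i < j" "c \<in> {A i, B i}" "d \<in> {A j, B j}"
    then show "t c \<otimes> t d = t d \<otimes> t c"
      using apart[of i j "collapse c" "collapse d"] by (auto simp: t)
  qed (use carrs central main gen in \<open>auto simp: t \<sigma>_def\<close>)
  have tsurf: "satisfies G t (surface_braid_rels n g TSig TA TB)"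
  proof (rule satisfies_surface_braid_relsI[of \<tau>])
    fix i j c d assume "i \<in> {1..g}" "j \<in> {1..g}" "i < j" "c \<in> {TA i, TB i}" "d \<in> {TA j, TB j}"
    then show "t c \<otimes> t d = t d \<otimes> t c"
      using apart[of i j "collapse c" "collapse d"] by (auto simp: t)
  qed (use carrs central main gen in \<open>auto simp: t \<tau>_def\<close>)
  have ab: "t c \<in> carrier G" "t c \<otimes> \<sigma> = \<sigma> \<otimes> t c" "t c \<otimes> \<tau> = \<tau> \<otimes> t c" "t c \<otimes> \<zeta> = \<zeta> \<otimes> t c"
    if "c \<in> gens_AB g \<union> gens_TAB g" for c
    using that carrs central gen by (auto simp: t gens_defs)
  have t_simps: "t (Sig i) = \<sigma>" "t (TSig i) = \<tau>" "t (Zeta i) = \<zeta>" for i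
    by (simp_all add: t \<sigma>_def \<tau>_def \<zeta>_def)
  have base: "\<tau> \<otimes> \<sigma> = \<sigma> \<otimes> \<tau>" "\<zeta> \<otimes> \<sigma> = \<sigma> \<otimes> \<zeta>" "\<tau> \<otimes> \<zeta> = \<zeta> \<otimes> \<tau>"
    using central[of QTSig] central[of QZeta] by (auto simp: \<tau>_def \<zeta>_def quotient_gens_def)
  have \<sigma>\<zeta>: "inv \<sigma> \<otimes> (\<zeta> \<otimes> \<sigma>) = \<zeta>"
    using conj_commute(2)[of \<sigma> \<zeta>] carrs base by (simp add: m_assoc)
  have \<sigma>\<zeta>c: "inv \<sigma> \<otimes> (\<zeta> \<otimes> (\<sigma> \<otimes> c)) = \<zeta> \<otimes> c" if "c \<in> carrier G" for c
    using that carrs(1,3) arg_cong[OF \<sigma>\<zeta>, of "\<lambda>x. x \<otimes> c"] by (simp add: m_assoc)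
  have zeta: "satisfies G t (zeta_rels k n g)"
    unfolding zeta_rels_def satisfies_unfold
    apply (intro conjI allI impI)
    subgoal for i j
      using carrs base(2) t_simps by (simp add: weval_Cons)
    subgoal for j
      using carrs base(2) t_simps commute_m_left[of \<zeta> \<sigma> "\<sigma> \<otimes> \<zeta>"] by (simp add: weval_Cons)
    subgoal for c i
      using ab[of c] carrs \<sigma>\<zeta> \<sigma>\<zeta>c t_simps by (simp add: weval_Cons winv_Cons)
    subgoal for i j
      using carrs \<sigma>\<zeta> \<sigma>\<zeta>c t_simps by (simp add: weval_Cons winv_Cons)
    done
  have pairs: "t x' \<in> carrier G" "t x \<in> carrier G"
      "t x' \<otimes> t x = t x \<otimes> t x'" "t x' \<otimes> \<zeta> = \<zeta> \<otimes> t x'" "t x \<otimes> \<zeta> = \<zeta> \<otimes> t x"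
      "gcomm G (inv (t x)) (inv \<zeta>) = \<one>"
    if "i \<in> {1..g}" "(x', x) \<in> tilde_pairs i" for i x' x
  proof -
    have g: "x' \<in> gens_AB g \<union> gens_TAB g" "x \<in> gens_AB g \<union> gens_TAB g"
      using that by (auto simp: tilde_pairs_def gens_defs)
    show carr: "t x' \<in> carrier G" "t x \<in> carrier G"
      and "t x' \<otimes> \<zeta> = \<zeta> \<otimes> t x'" and x: "t x \<otimes> \<zeta> = \<zeta> \<otimes> t x"
      using ab g by blast+
    show "t x' \<otimes> t x = t x \<otimes> t x'"
      using that same by (auto simp: t tilde_pairs_def)
    show "gcomm G (inv (t x)) (inv \<zeta>) = \<one>"
      using gcomm_inv_inv_commute[OF carr(2) carrs(3) x] .
  qed
  have other: "t d \<in> carrier G" "t x' \<otimes> t d = t d \<otimes> t x'"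
    if "i \<in> {1..g}" "j \<in> {1..g}" "i \<noteq> j" "(x', x) \<in> tilde_pairs i" "d \<in> {A j, B j}" for i j x' x d
    using that apart[of i j "collapse x'" "collapse d"] carrs by (auto simp: t tilde_pairs_def)
  have conj_\<zeta>: "inv \<zeta> \<otimes> (y \<otimes> \<zeta>) = y" if "y \<in> carrier G" "y \<otimes> \<zeta> = \<zeta> \<otimes> y" for y
    using conj_commute(2)[of \<zeta> y] that carrs by (simp add: m_assoc)
  have AB: "t (A i) \<in> carrier G" "t (B i) \<in> carrier G" "t (TA i) \<in> carrier G" "t (TB i) \<in> carrier G"
    "t (A i) \<otimes> \<zeta> = \<zeta> \<otimes> t (A i)" "t (B i) \<otimes> \<zeta> = \<zeta> \<otimes> t (B i)" if "i \<in> {1..g}" for i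
    using that ab by (auto simp: gens_defs)
  \<comment> \<open>Both formulas say that a commutator equals \<zeta>, but the tilde letter comes
    first in one and second in the other. This accounts for \<zeta> in the first conjugate and its
    inverse in the second.\<close>
  have twist: "t (TA i) \<otimes> t (B i) \<otimes> inv (t (TA i)) = t (B i) \<otimes> \<zeta>"
    "t (TB i) \<otimes> t (A i) \<otimes> inv (t (TB i)) = inv \<zeta> \<otimes> t (A i)" if "i \<in> {1..g}" for i
  proof -
    have "t (TA i) \<otimes> t (B i) = \<zeta> \<otimes> (t (B i) \<otimes> t (TA i))" "t (A i) \<otimes> t (TB i) = \<zeta> \<otimes> (t (TB i) \<otimes> t (A i))"
      using main that by (auto simp: t)
    then show "t (TA i) \<otimes> t (B i) \<otimes> inv (t (TA i)) = t (B i) \<otimes> \<zeta>"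
      "t (TB i) \<otimes> t (A i) \<otimes> inv (t (TB i)) = inv \<zeta> \<otimes> t (A i)"
      using AB[OF that] carrs(3) commute_up_to by auto
  qed
  have mixed: "satisfies G t (mixed_rels k n g)"
    unfolding mixed_rels_def satisfies_unfold
    \<comment> \<open>The subgoals are the twelve families in the order of
      \<open>mixed_rels\<close>.\<close>
    apply (intro conjI allI impI)
    subgoal for c j
      using carrs ab[of c] base(1) t_simps
      by (cases "c \<in> gens_TS n") (auto simp: weval_Cons gens_defs)
    subgoal for i c
      using carrs ab[of c] t_simps by (simp add: weval_Cons)
    subgoal for i
      using carrs t_simps conj_commute(1)[of \<tau> \<zeta>] base(3) by (simp add: weval_simps)
    subgoal for i
      using carrs t_simps conj_commute(1)[of \<tau> \<zeta>] base(3) conj_\<zeta>[of \<zeta>]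
      by (simp add: weval_simps weval_Cons winv_Cons)
    subgoal for i j
      using carrs t_simps conj_commute(1)[of \<tau> \<zeta>] base(3) by (simp add: weval_simps)
    subgoal for x' x i
      using pairs[of i x' x] carrs t_simps conj_commute(1)[of "t x'" \<zeta>]
        conj_commute(2)[of "t x \<otimes> \<zeta>" \<zeta>]
      by (simp add: weval_simps weval_Cons m_assoc commute_m_left)
    subgoal for x' x i j
      using pairs[of i x' x] carrs t_simps conj_commute(1)[of "t x'" \<zeta>]
      by (simp add: weval_simps words_wcomm)
    subgoal for x' x i
      using pairs[of i x' x] carrs t_simps conj_commute(1)[of "t x'" "t x"] conj_\<zeta>[of "t x"]
      by (simp add: weval_simps weval_Cons winv_Cons)
    subgoal for x' x d i j
      using pairs[of i x' x] other[of i j x' x d] carrs t_simps conj_commute(1)[of "t x'" "t d"]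
      by (simp add: weval_simps words_wcomm)
    subgoal for x' x d i j
      using pairs[of i x' x] other[of i j x' x d] carrs t_simps conj_commute(1)[of "t x'" "t d"]
      by (simp add: weval_simps)
    subgoal for i
      using AB[of i] carrs(3) t_simps twist(1) by (simp add: weval_simps weval_Cons)
    subgoal for i
      using AB[of i] carrs(3) t_simps twist(2)[of i] pairs(6)[of i "TB i" "B i"]
      by (simp add: weval_simps weval_Cons winv_Cons words_wcomm tilde_pairs_def)
    done
  show ?thesis
    unfolding braid_rels_def t_def[symmetric] using surf tsurf zeta mixed by simp
qed

text \<open>Applied to the quotient by the third term of the series, this says that the obvious map
  from the group with the stated presentation is well defined and that its image contains every
  braid generator.\<close>

lemma (in group) class_two_satisfies_braid_relsD:
  assumes two: "class_two G" and k: "k \<ge> 3" and n: "n \<ge> 3"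
    and carr: "p ` braid_gens k n g \<subseteq> carrier G"
    and sat: "satisfies G p (braid_rels k n g)"
  shows "x \<in> braid_gens k n g \<Longrightarrow> p x = p (representative (collapse x))"
    and "satisfies G (p \<circ> representative) (quotient_rels g)"
proof -
  have S: "satisfies G p (surface_braid_rels k g Sig A B)" and Z: "satisfies G p (zeta_rels k n g)"
    and T: "satisfies G p (surface_braid_rels n g TSig TA TB)" and M: "satisfies G p (mixed_rels k n g)"
    using sat by (simp_all add: braid_rels_def)
  have p_carr: "\<And>i. i \<in> {1..<k} \<Longrightarrow> p (Sig i) \<in> carrier G" "\<And>i. i \<in> {1..<n} \<Longrightarrow> p (TSig i) \<in> carrier G"
    "\<And>i. i \<in> {1..n} \<Longrightarrow> p (Zeta i) \<in> carrier G"
    "\<And>i. i \<in> {1..g} \<Longrightarrow> p (A i) \<in> carrier G" "\<And>i. i \<in> {1..g} \<Longrightarrow> p (B i) \<in> carrier G"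
    "\<And>i. i \<in> {1..g} \<Longrightarrow> p (TA i) \<in> carrier G" "\<And>i. i \<in> {1..g} \<Longrightarrow> p (TB i) \<in> carrier G"
    by (auto intro!: carr[THEN subsetD] simp: braid_gens_def gens_defs)
  have "p ` Sig ` {1..<k} \<subseteq> carrier G" "p ` A ` {1..g} \<subseteq> carrier G" "p ` B ` {1..g} \<subseteq> carrier G"
    "p ` TSig ` {1..<n} \<subseteq> carrier G" "p ` TA ` {1..g} \<subseteq> carrier G" "p ` TB ` {1..g} \<subseteq> carrier G"
    using p_carr by auto
  note S = satisfies_surface_braid_relsD[OF two k S this(1-3)]
    and T = satisfies_surface_braid_relsD[OF two n T this(4-6)]
  define \<sigma> \<tau> \<zeta> where "\<sigma> = p (Sig 1)" and "\<tau> = p (TSig 1)" and "\<zeta> = p (Zeta 1)"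
  have c[simp]: "\<sigma> \<in> carrier G" "\<tau> \<in> carrier G" "\<zeta> \<in> carrier G"
    using p_carr k n by (simp_all add: \<sigma>_def \<tau>_def \<zeta>_def)
  have first: "p (Sig (Suc 0)) = \<sigma>" "p (TSig (Suc 0)) = \<tau>" "p (Zeta (Suc 0)) = \<zeta>"
    by (simp_all add: \<sigma>_def \<tau>_def \<zeta>_def)
  have \<sigma>: "p (Sig i) = \<sigma>" if "i \<in> {1..<k}" for i
    using S(1)[OF that] unfolding \<sigma>_def .
  have \<tau>: "p (TSig i) = \<tau>" if "i \<in> {1..<n}" for i
    using T(1)[OF that] unfolding \<tau>_def .
  have conjD: "x \<otimes> y = y \<otimes> x" if "x \<otimes> y \<otimes> inv x = y" "x \<in> carrier G" "y \<in> carrier G" for x y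
    using that inv_solve_right'[of y "x \<otimes> y" x] by simp
  note Z = Z[unfolded zeta_rels_def satisfies_unfold]
  \<comment> \<open>\<open>Z(1)\<close> says that \<zeta> commutes with \<open>Sig i\<close> for
    \<open>i \<noteq> 1\<close>; \<open>Z(2)\<close> is the family of conjugates of \<zeta>
    commuting with \<open>gens_AB\<close>.\<close>
  note Z = Z[THEN conjunct1, THEN conjunct1, THEN conjunct1, rule_format]
    Z[THEN conjunct1, THEN conjunct2, rule_format]
  \<comment> \<open>\<open>M1\<close> is the first family of relations in \<open>mixed_rels\<close>; for \<open>i > 1\<close> the \<open>i\<close>-th family is
    the second conjunct of \<open>Mi\<close>.\<close>
  note M12 = M[unfolded mixed_rels_def satisfies_unfold]
  note M11 = M12[THEN conjunct1] note M10 = M11[THEN conjunct1] note M9 = M10[THEN conjunct1]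
  note M8 = M9[THEN conjunct1] note M7 = M8[THEN conjunct1] note M6 = M7[THEN conjunct1]
  note M5 = M6[THEN conjunct1] note M4 = M5[THEN conjunct1] note M3 = M4[THEN conjunct1]
  note M2 = M3[THEN conjunct1] note M1 = M2[THEN conjunct1]
  \<comment> \<open>\<open>TSig 2\<close> fixes \<open>Zeta 1\<close> because 1 is neither 2 nor 3;
    it exists because \<open>n \<ge> 3\<close>, and its value is \<tau>.\<close>
  have \<tau>\<zeta>: "\<tau> \<otimes> \<zeta> = \<zeta> \<otimes> \<tau>"
    using M5[THEN conjunct2, rule_format, of 2 1] n \<tau>[of 2] conjD[of \<tau> \<zeta>]
    by (simp add: weval_simps first)
  have \<zeta>: "p (Zeta i) = \<zeta>" if "i \<in> {1..n}" for i
  proof -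
    have "i \<ge> 1" "i \<le> n" using that by auto
    then show ?thesis
    proof (induction i rule: dec_induct)
      case (step i)
      have z: "p (Zeta (Suc i)) \<in> carrier G" using step p_carr by simp
      \<comment> \<open>Conjugation by \<tau> lowers the index by one, and by induction the result
        is \<zeta>. Since \<tau> commutes with \<zeta>, the element conjugated was already
        \<zeta>.\<close>
      have "\<tau> \<otimes> p (Zeta (Suc i)) \<otimes> inv \<tau> = \<zeta>"
        using M3[THEN conjunct2, rule_format, of i] step \<tau>[of i] z by (simp add: weval_simps)
      then have "\<tau> \<otimes> p (Zeta (Suc i)) = \<tau> \<otimes> \<zeta>"
        using z \<tau>\<zeta> inv_solve_right'[of \<zeta> "\<tau> \<otimes> p (Zeta (Suc i))" \<tau>] by simp
      then show ?case using z by simp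
    qed (simp add: \<zeta>_def)
  qed
  have \<zeta>\<sigma>: "\<zeta> \<otimes> \<sigma> = \<sigma> \<otimes> \<zeta>"
    using Z(1)[of 2 1] k n \<sigma>[of 2] by (simp add: weval_Cons first)
  have \<tau>\<sigma>: "\<tau> \<otimes> \<sigma> = \<sigma> \<otimes> \<tau>"
    using M1[rule_format, of "TSig 1" 1] k n
    by (simp add: weval_Cons gens_defs first)
  have AB: "p x \<in> carrier G" "p x \<otimes> \<sigma> = \<sigma> \<otimes> p x" "p x \<otimes> \<tau> = \<tau> \<otimes> p x" "p x \<otimes> \<zeta> = \<zeta> \<otimes> p x"
    if x: "x \<in> gens_AB g" for x
  proof -
    show px: "p x \<in> carrier G"
      using x p_carr by (auto simp: gens_defs)
    show "p x \<otimes> \<sigma> = \<sigma> \<otimes> p x"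
      using S(2)[of x] x unfolding gens_defs \<sigma>_def by blast
    show "p x \<otimes> \<tau> = \<tau> \<otimes> p x"
      using M2[THEN conjunct2, rule_format, of 1 x] x n px by (simp add: weval_Cons first)
    \<comment> \<open>The relation speaks of the conjugate of \<zeta> by \<sigma>, which is \<zeta>
      itself by \<open>\<zeta>\<sigma>\<close>.\<close>
    have "inv \<sigma> \<otimes> (\<zeta> \<otimes> (\<sigma> \<otimes> p x)) = p x \<otimes> (inv \<sigma> \<otimes> (\<zeta> \<otimes> \<sigma>))"
      using Z(2)[of 1 x] x k n px by (simp add: weval_Cons winv_Cons first)
    then have "inv \<sigma> \<otimes> (\<zeta> \<otimes> \<sigma>) \<otimes> p x = p x \<otimes> (inv \<sigma> \<otimes> (\<zeta> \<otimes> \<sigma>))"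
      using px by (simp add: m_assoc)
    moreover have "inv \<sigma> \<otimes> (\<zeta> \<otimes> \<sigma>) = \<zeta>"
      using conj_commute(2)[of \<sigma> \<zeta>] \<zeta>\<sigma> by (simp add: m_assoc)
    ultimately show "p x \<otimes> \<zeta> = \<zeta> \<otimes> p x" by simp
  qed
  \<comment> \<open>This has to precede \<open>TAB\<close>: tilde letters commute with \<zeta> only
    because their action on it is conjugation by \<open>x\<zeta>\<close>, and that product commutes
    with \<zeta> by \<open>AB\<close>.\<close>
  have pair: "x \<in> gens_AB g" "p x' \<in> carrier G" "gcomm G (inv (p x)) (inv \<zeta>) = \<one>"
    "p x' \<otimes> \<zeta> = \<zeta> \<otimes> p x'" "p x' \<otimes> p x = p x \<otimes> p x'"
    if i: "i \<in> {1..g}" "(x', x) \<in> tilde_pairs i" for i x' x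
  proof -
    show x: "x \<in> gens_AB g" and x': "p x' \<in> carrier G"
      using i p_carr by (auto simp: tilde_pairs_def gens_defs)
    note x = AB[OF x]
    show "gcomm G (inv (p x)) (inv \<zeta>) = \<one>"
      using gcomm_inv_inv_commute[OF x(1) c(3) x(4)] .
    have "p x' \<otimes> \<zeta> \<otimes> inv (p x') = inv (p x \<otimes> \<zeta>) \<otimes> \<zeta> \<otimes> (p x \<otimes> \<zeta>)"
      using M6[THEN conjunct2, rule_format, of i x' x] i n x(1) x'
      by (simp add: weval_simps weval_Cons first)
    moreover have "inv (p x \<otimes> \<zeta>) \<otimes> \<zeta> \<otimes> (p x \<otimes> \<zeta>) = \<zeta>"
      using x by (intro conj_commute(2)) (simp_all add: m_assoc commute_m_left)
    ultimately show "p x' \<otimes> \<zeta> = \<zeta> \<otimes> p x'"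
      using x' by (intro conjD) simp_all
    have "p x' \<otimes> p x \<otimes> inv (p x') = inv \<zeta> \<otimes> (p x \<otimes> \<zeta>)"
      using M8[THEN conjunct2, rule_format, of i x' x] i n x(1) x'
      by (simp add: weval_simps weval_Cons winv_Cons first)
    moreover have "inv \<zeta> \<otimes> (p x \<otimes> \<zeta>) = p x"
      using conj_commute(2)[of \<zeta> "p x"] x by (simp add: m_assoc)
    ultimately show "p x' \<otimes> p x = p x \<otimes> p x'"
      using x(1) x' by (intro conjD) simp_all
  qed
  have TAB: "p x \<in> carrier G" "p x \<otimes> \<sigma> = \<sigma> \<otimes> p x" "p x \<otimes> \<tau> = \<tau> \<otimes> p x" "p x \<otimes> \<zeta> = \<zeta> \<otimes> p x"
    if x: "x \<in> gens_TAB g" for x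
  proof -
    show px: "p x \<in> carrier G"
      using x p_carr by (auto simp: gens_defs)
    show "p x \<otimes> \<tau> = \<tau> \<otimes> p x"
      using T(2)[of x] x unfolding gens_defs \<tau>_def by blast
    show "p x \<otimes> \<sigma> = \<sigma> \<otimes> p x"
      using M1[rule_format, of x 1] x k px by (simp add: weval_Cons first)
    show "p x \<otimes> \<zeta> = \<zeta> \<otimes> p x"
      using x pair(4) by (auto simp: gens_defs tilde_pairs_def)
  qed
  have apart: "p x' \<otimes> p d = p d \<otimes> p x'"
    if i: "i \<in> {1..g}" "j \<in> {1..g}" "i \<noteq> j" "(x', x) \<in> tilde_pairs i" and d: "d \<in> {A j, B j}" for i j x' x d
  proof -
    have pd: "p d \<in> carrier G"
      using i d p_carr by auto
    note x = AB(1)[OF pair(1)[OF i(1,4)]] pair(2,3)[OF i(1,4)]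
    \<comment> \<open>For \<open>i < j\<close> this is a relation as it stands. For
      \<open>i > j\<close> the relation has an additional conjugation by a commutator that
      \<open>pair(3)\<close> makes trivial.\<close>
    have "p x' \<otimes> p d \<otimes> inv (p x') = p d"
    proof (cases "i < j")
      case True
      then show ?thesis
        using M10[THEN conjunct2, rule_format, of i j x' x d] i d pd x by (simp add: weval_simps)
    next
      case False
      then show ?thesis
        using M9[THEN conjunct2, rule_format, of i j x' x d] i d n pd x
        by (simp add: weval_simps words_wcomm first)
    qed
    then show ?thesis
      using pd x by (intro conjD) simp_all
  qed
  have twist: "p (TA i) \<otimes> p (B i) = \<zeta> \<otimes> (p (B i) \<otimes> p (TA i))"
    "p (A i) \<otimes> p (TB i) = \<zeta> \<otimes> (p (TB i) \<otimes> p (A i))" if i: "i \<in> {1..g}" for i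
  proof -
    note pc = p_carr(4-7)[OF i]
    have g: "gcomm G (inv (p (B i))) (inv \<zeta>) = \<one>" "p (B i) \<otimes> \<zeta> = \<zeta> \<otimes> p (B i)"
      using pair(3)[OF i, of "TB i" "B i"] AB(4)[of "B i"] i by (auto simp: tilde_pairs_def gens_defs)
    have "p (TA i) \<otimes> p (B i) \<otimes> inv (p (TA i)) = \<zeta> \<otimes> p (B i)"
      using M11[THEN conjunct2, rule_format, of i] i n pc g(2)
      by (simp add: weval_simps weval_Cons first)
    then show "p (TA i) \<otimes> p (B i) = \<zeta> \<otimes> (p (B i) \<otimes> p (TA i))"
      using pc inv_solve_right'[of "\<zeta> \<otimes> p (B i)" "p (TA i) \<otimes> p (B i)" "p (TA i)"]
      by (simp add: m_assoc)
    \<comment> \<open>The trailing commutator in the relation vanishes by \<open>g(1)\<close>. The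
      surviving inverse of \<zeta> changes sides when the formula is read with \<open>A i\<close> in
      front.\<close>
    have "p (TB i) \<otimes> p (A i) \<otimes> inv (p (TB i)) = inv \<zeta> \<otimes> p (A i)"
      using M12[THEN conjunct2, rule_format, of i] i n pc g(1)
      by (simp add: weval_simps weval_Cons winv_Cons words_wcomm first)
    then have "p (TB i) \<otimes> p (A i) = inv \<zeta> \<otimes> (p (A i) \<otimes> p (TB i))"
      using pc inv_solve_right'[of "inv \<zeta> \<otimes> p (A i)" "p (TB i) \<otimes> p (A i)" "p (TB i)"]
      by (simp add: m_assoc)
    then show "p (A i) \<otimes> p (TB i) = \<zeta> \<otimes> (p (TB i) \<otimes> p (A i))"
      using pc inv_solve_left[of "p (TB i) \<otimes> p (A i)" \<zeta> "p (A i) \<otimes> p (TB i)"] by simp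
  qed
  show "x \<in> braid_gens k n g \<Longrightarrow> p x = p (representative (collapse x))"
    by (auto simp: braid_gens_def gens_defs first \<sigma> \<tau> \<zeta>)
  define q where "q = p \<circ> representative"
  have q: "q QSig = \<sigma>" "q QTSig = \<tau>" "q QZeta = \<zeta>" "\<And>i. q (QA i) = p (A i)"
    "\<And>i. q (QB i) = p (B i)" "\<And>i. q (QTA i) = p (TA i)" "\<And>i. q (QTB i) = p (TB i)"
    by (simp_all add: q_def \<sigma>_def \<tau>_def \<zeta>_def)
  have q_carr: "q ` quotient_gens g \<subseteq> carrier G"
    using p_carr by (auto simp: quotient_gens_def q)
  have central: "q x \<otimes> \<sigma> = \<sigma> \<otimes> q x" "q x \<otimes> \<tau> = \<tau> \<otimes> q x" "q x \<otimes> \<zeta> = \<zeta> \<otimes> q x"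
    if "x \<in> quotient_gens g" for x
    using that AB TAB \<tau>\<zeta> \<zeta>\<sigma> \<tau>\<sigma> by (auto simp: quotient_gens_def q gens_defs)
  have others: "p x \<otimes> p y = p y \<otimes> p x"
    if i: "i \<in> {1..g}" "j \<in> {1..g}" "i \<noteq> j" and x: "x \<in> {A i, B i, TA i, TB i}" and y: "y \<in> {A j, B j, TA j, TB j}"
    for i j x y
  proof -
    consider "x \<in> {A i, B i}" "y \<in> {A j, B j}" | "x \<in> {TA i, TB i}" "y \<in> {TA j, TB j}"
      | "x \<in> {TA i, TB i}" "y \<in> {A j, B j}" | "x \<in> {A i, B i}" "y \<in> {TA j, TB j}"
      using x y by blast
    then show ?thesis
    proof cases
      case 1
      then show ?thesis using S(4)[OF i] by blast
    next
      case 2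
      then show ?thesis using T(4)[OF i] by blast
    next
      case 3
      then show ?thesis using apart[OF i] by (auto simp: tilde_pairs_def)
    next
      case 4
      then show ?thesis using apart[OF i(2,1) i(3)[symmetric], of y _ x] by (auto simp: tilde_pairs_def)
    qed
  qed
  have indexed: "\<exists>i\<in>{1..g}. x \<in> {QA i, QB i, QTA i, QTB i}"
    if "x \<in> quotient_gens g" "x \<notin> {QSig, QTSig, QZeta}" for x
    using that by (auto simp: quotient_gens_def)
  have comm: "q x \<otimes> q y = q y \<otimes> q x"
    if xy: "x \<in> quotient_gens g" "y \<in> quotient_gens g" "x \<noteq> y" "{x, y} \<notin> noncommuting_pairs g" for x y
  proof (cases "x \<in> {QSig, QTSig, QZeta} \<or> y \<in> {QSig, QTSig, QZeta}")
    case True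
    then show ?thesis using central xy(1,2) by (auto simp: q)
  next
    case False
    then obtain i j where i: "i \<in> {1..g}" "x \<in> {QA i, QB i, QTA i, QTB i}"
      and j: "j \<in> {1..g}" "y \<in> {QA j, QB j, QTA j, QTB j}"
      using indexed xy(1,2) by meson
    show ?thesis
    proof (cases "i = j")
      case False
      have "representative x \<in> {A i, B i, TA i, TB i}" "representative y \<in> {A j, B j, TA j, TB j}"
        using i(2) j(2) by auto
      then show ?thesis
        using others[OF i(1) j(1) False] by (simp only: q_def comp_apply)
    next
      \<comment> \<open>Of the pairs with a common index, all but \<open>{QTA i, QA i}\<close> and
        \<open>{QTB i, QB i}\<close> are noncommuting pairs. They are recorded in both orders so
        that every combination of \<open>x\<close> and \<open>y\<close> is matched.\<close>
      case True
      have nc: "{QA i, QB i} \<in> noncommuting_pairs g" "{QTA i, QTB i} \<in> noncommuting_pairs g"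
        "{QB i, QTA i} \<in> noncommuting_pairs g" "{QTB i, QA i} \<in> noncommuting_pairs g"
        using i(1) by (auto simp: noncommuting_pairs_def)
      then have "{QB i, QA i} \<in> noncommuting_pairs g" "{QTB i, QTA i} \<in> noncommuting_pairs g"
        "{QTA i, QB i} \<in> noncommuting_pairs g" "{QA i, QTB i} \<in> noncommuting_pairs g"
        by (simp_all only: insert_commute)
      moreover have "p (TA i) \<otimes> p (A i) = p (A i) \<otimes> p (TA i)" "p (TB i) \<otimes> p (B i) = p (B i) \<otimes> p (TB i)"
        using pair(5)[OF i(1)] by (auto simp: tilde_pairs_def)
      ultimately show ?thesis
        using i(2) j(2) True xy(3,4) nc by (auto simp: q)
    qed
  qed
  have "satisfies G q (quotient_rels g)"
    unfolding satisfies_quotient_rels_iff[OF q_carr]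
  proof (intro conjI ballI impI)
    fix i assume i: "i \<in> {1..g}"
    show "q (QA i) \<otimes> q (QB i) = q QSig \<otimes> q QSig \<otimes> (q (QB i) \<otimes> q (QA i))"
      using S(3)[OF i] unfolding q \<sigma>_def .
    show "q (QTA i) \<otimes> q (QTB i) = q QTSig \<otimes> q QTSig \<otimes> (q (QTB i) \<otimes> q (QTA i))"
      using T(3)[OF i] unfolding q \<tau>_def .
    show "q (QA i) \<otimes> q (QTB i) = q QZeta \<otimes> (q (QTB i) \<otimes> q (QA i))"
      "q (QTA i) \<otimes> q (QB i) = q QZeta \<otimes> (q (QB i) \<otimes> q (QTA i))"
      using twist[OF i] unfolding q by blast+
  qed (use comm in blast)
  then show "satisfies G (p \<circ> representative) (quotient_rels g)"
    by (simp add: q_def)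
qed

section \<open>The presentation of the class-two quotient\<close>

lemma quotient_rels_subset_words: "quotient_rels g \<subseteq> words (quotient_gens g) \<times> words (quotient_gens g)"
  by (auto simp: quotient_rels_def wcommute_def wcomm_def quotient_gens_def)

text \<open>\<open>QSig\<close>, \<open>QTSig\<close> and \<open>QZeta\<close> occur in no
  noncommuting pair, so their values are central. A commutator of generators is trivial or, up to
  inversion, a product of such values.\<close>

lemma (in group) satisfies_quotient_rels_class_two:
  assumes carr: "q ` quotient_gens g \<subseteq> carrier G" and gen: "generate G (q ` quotient_gens g) = carrier G"
    and sat: "satisfies G q (quotient_rels g)"
  shows "class_two G"
proof (rule class_twoI_generators[OF carr gen])
  interpret C: subgroup "group_center G" G by (rule subgroup_group_center)
  have q_carr: "q x \<in> carrier G" if "x \<in> quotient_gens g" for x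
    using carr that by auto
  note rels = sat[unfolded satisfies_quotient_rels_iff[OF carr]]
  have comm: "q x \<otimes> q y = q y \<otimes> q x"
    if "x \<in> quotient_gens g" "y \<in> quotient_gens g" "{x, y} \<notin> noncommuting_pairs g" for x y
    using that rels by (cases "x = y") blast+
  have central: "q c \<in> group_center G" if "c \<in> {QSig, QTSig, QZeta}" for c
  proof (rule group_centerI_generators[OF carr gen])
    have c: "c \<in> quotient_gens g" "{c, x} \<notin> noncommuting_pairs g" for x
      using that by (auto simp: quotient_gens_def noncommuting_pairs_def doubleton_eq_iff)
    then show "q c \<in> carrier G" by (simp add: q_carr)
    show "q c \<otimes> y = y \<otimes> q c" if "y \<in> q ` quotient_gens g" for y
      using that c comm by blast
  qed
  have pair: "gcomm G (q x) (q y) \<in> group_center G"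
    if "i \<in> {1..g}" "(x, y) \<in> {(QA i, QB i), (QTA i, QTB i), (QTA i, QB i), (QA i, QTB i)}" for i x y
  proof -
    have x: "q x \<in> carrier G" "q y \<in> carrier G"
      using that q_carr by (auto simp: quotient_gens_def)
    have "\<exists>z\<in>{q QSig \<otimes> q QSig, q QTSig \<otimes> q QTSig, q QZeta}. q x \<otimes> q y = z \<otimes> (q y \<otimes> q x)"
      using that(2) rels[THEN conjunct2, THEN bspec, OF that(1)] by auto
    then obtain z where z: "z \<in> {q QSig \<otimes> q QSig, q QTSig \<otimes> q QTSig, q QZeta}"
      "q x \<otimes> q y = z \<otimes> (q y \<otimes> q x)" by blast
    have "z \<in> group_center G"
      using z(1) central by auto
    then have "gcomm G (q x) (q y) = z"
      using x z(2) by (simp add: gcomm_eq_iff)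
    with \<open>z \<in> group_center G\<close> show ?thesis by simp
  qed
  fix a b assume "a \<in> q ` quotient_gens g" "b \<in> q ` quotient_gens g"
  then obtain x y where x: "a = q x" "x \<in> quotient_gens g" and y: "b = q y" "y \<in> quotient_gens g" by auto
  show "gcomm G a b \<in> group_center G"
  proof (cases "{x, y} \<in> noncommuting_pairs g")
    case True
    then obtain i where i: "i \<in> {1..g}"
      "(x, y) \<in> {(QA i, QB i), (QTA i, QTB i), (QTA i, QB i), (QA i, QTB i)} \<or>
       (y, x) \<in> {(QA i, QB i), (QTA i, QTB i), (QTA i, QB i), (QA i, QTB i)}"
      unfolding noncommuting_pairs_def by (auto simp: doubleton_eq_iff)
    then show ?thesis
      using pair[of i x y] pair[of i y x] x y gcomm_swap[of b a] q_carr by auto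
  next
    case False
    then have "a \<otimes> b = b \<otimes> a"
      unfolding x(1) y(1) by (intro comm x(2) y(2))
    then have "gcomm G a b = \<one>"
      using x y q_carr by (simp add: gcomm_eq_one_iff)
    then show ?thesis by simp
  qed
qed

lemma class_two_quotient_presentation:
  assumes k: "k \<ge> 3" and n: "n \<ge> 3" and G: "has_presentation G s (braid_gens k n g) (braid_rels k n g)"
  defines "\<pi> \<equiv> \<lambda>x. lower_central G 3 #>\<^bsub>G\<^esub> x"
  defines "q \<equiv> \<pi> \<circ> s \<circ> representative"
  shows "has_presentation (G Mod lower_central G 3) q (quotient_gens g) (quotient_rels g)"
    and "x \<in> braid_gens k n g \<Longrightarrow> \<pi> (s x) = q (collapse x)"
proof -
  let ?N = "lower_central G 3" and ?X = "braid_gens k n g" and ?Y = "quotient_gens g"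
  let ?Q = "G Mod ?N"
  interpret group G using G by (simp add: has_presentation_def)
  interpret normal ?N G by (rule normal_lower_central)
  interpret Q: group ?Q by (rule factorgroup_is_group)
  have \<pi>: "group_hom G ?Q \<pi>"
    unfolding \<pi>_def by (intro group_hom.intro group_hom_axioms.intro r_coset_hom_Mod is_group Q.is_group)
  interpret \<pi>: group_hom G ?Q \<pi> by fact
  have s: "s ` ?X \<subseteq> carrier G" and surj: "weval G s ` words ?X = carrier G"
    and words: "braid_rels k n g \<subseteq> words ?X \<times> words ?X"
    using G by (auto simp: has_presentation_def)
  have \<pi>s: "(\<pi> \<circ> s) ` ?X \<subseteq> carrier ?Q"
    using s by auto
  have "weval ?Q (\<pi> \<circ> s) u = weval ?Q (\<pi> \<circ> s) v" if "(u, v) \<in> braid_rels k n g" for u v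
  proof -
    have "u \<in> words ?X" "v \<in> words ?X" using that words by auto
    moreover have "weval G s u = weval G s v"
      using has_presentation_satisfies[OF G] that unfolding satisfies_def by blast
    ultimately show ?thesis
      by (simp flip: weval_hom[OF \<pi> s])
  qed
  then have "satisfies ?Q (\<pi> \<circ> s) (braid_rels k n g)"
    by (auto simp: satisfies_def)
  note D = Q.class_two_satisfies_braid_relsD[OF class_two_FactGroup k n \<pi>s this]
  then have eq: "\<pi> (s x) = q (collapse x)" if "x \<in> ?X" for x
    using that by (simp add: q_def)
  then show "x \<in> ?X \<Longrightarrow> \<pi> (s x) = q (collapse x)" .
  have sat: "satisfies ?Q q (quotient_rels g)"
    using D(2) by (simp add: q_def o_assoc)
  have q_carr: "q ` ?Y \<subseteq> carrier ?Q"
    using representative_in_braid_gens[of k n _ g] k n \<pi>s by (auto simp: q_def)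
  have gens: "weval ?Q q ` words ?Y = carrier ?Q"
  proof
    show "weval ?Q q ` words ?Y \<subseteq> carrier ?Q"
      using Q.weval_closed[OF q_carr] by auto
    show "carrier ?Q \<subseteq> weval ?Q q ` words ?Y"
    proof
      fix c assume "c \<in> carrier ?Q"
      then obtain y where y: "y \<in> carrier G" "c = \<pi> y"
        by (auto simp: carrier_FactGroup \<pi>_def)
      then have "y \<in> weval G s ` words ?X"
        by (simp only: surj)
      then obtain w where w: "w \<in> words ?X" "c = \<pi> (weval G s w)"
        using y(2) by auto
      \<comment> \<open>Collapsing a braid word letter by letter does not change its value in the
        quotient, by \<open>eq\<close>.\<close>
      let ?w = "map (\<lambda>p. (collapse (fst p), snd p)) w"
      have "c = weval ?Q (q \<circ> collapse) w"
        unfolding w(2) weval_hom[OF \<pi> s w(1)] using eq by (intro weval_cong[OF w(1)]) simp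
      then have "c = weval ?Q q ?w"
        by (simp add: weval_map)
      moreover have "?w \<in> words ?Y"
        using w(1) by (induction w) (auto simp: collapse_in_quotient_gens)
      ultimately show "c \<in> weval ?Q q ` words ?Y" by blast
    qed
  qed
  let ?P = "presented_group ?Y (quotient_rels g)" and ?t = "pres_gen ?Y (quotient_rels g)"
  interpret P: group ?P by (rule group_presented_group)
  have P: "has_presentation ?P ?t ?Y (quotient_rels g)"
    by (rule has_presentation_presented_group[OF quotient_rels_subset_words])
  have t: "?t ` ?Y \<subseteq> carrier ?P"
    using P by (simp add: has_presentation_def)
  note P_sat = has_presentation_satisfies[OF P]
  have P_two: "class_two ?P"
    by (rule P.satisfies_quotient_rels_class_two[OF t has_presentation_generate[OF P] P_sat])
  have "satisfies ?P (?t \<circ> collapse) (braid_rels k n g)"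
    by (rule P.satisfies_quotient_imp_braid_rels[OF t P_sat])
  moreover have "(?t \<circ> collapse) ` ?X \<subseteq> carrier ?P"
    using t collapse_in_quotient_gens by (auto simp: image_subset_iff)
  ultimately obtain \<phi> where \<phi>: "group_hom G ?P \<phi>" "\<And>x. x \<in> ?X \<Longrightarrow> \<phi> (s x) = ?t (collapse x)"
    using von_Dyck[OF G P.is_group] by (metis comp_apply)
  interpret \<phi>: group_hom G ?P \<phi> by fact
  \<comment> \<open>Here class two of \<open>?P\<close> pays off: \<phi> factors through the
    quotient.\<close>
  have "?N \<subseteq> kernel G ?P \<phi>"
    using \<phi>.lower_central_3_kernel[OF P_two] subset by (auto simp: kernel_def)
  then obtain \<psi> where \<psi>: "\<psi> \<in> hom ?Q ?P" "\<And>c. c \<in> carrier G \<Longrightarrow> \<psi> (\<pi> c) = \<phi> c"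
    using \<phi>.FactGroup_universal_kernel[OF normal_lower_central] unfolding \<pi>_def by metis
  have \<psi>_hom: "group_hom ?Q ?P \<psi>"
    using \<psi>(1) by (simp add: group_hom.intro group_hom_axioms.intro Q.is_group P.is_group)
  have \<psi>q: "\<psi> (q y) = ?t y" if "y \<in> ?Y" for y
  proof -
    have "representative y \<in> ?X"
      using representative_in_braid_gens that k n by simp
    then show ?thesis
      using \<phi>(2)[of "representative y"] \<psi>(2) s by (auto simp: q_def)
  qed
  have \<psi>_weval: "\<psi> (weval ?Q q w) = pres_class ?Y (quotient_rels g) w" if "w \<in> words ?Y" for w
  proof -
    have "\<psi> (weval ?Q q w) = weval ?P ?t w"
      unfolding weval_hom[OF \<psi>_hom q_carr that] using \<psi>q by (intro weval_cong[OF that]) simp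
    then show ?thesis
      using that by (simp add: weval_presented_group)
  qed
  have "weval ?Q q u = weval ?Q q v \<longleftrightarrow> pres_eq ?Y (quotient_rels g) u v"
    if uv: "u \<in> words ?Y" "v \<in> words ?Y" for u v
  proof
    assume "weval ?Q q u = weval ?Q q v"
    then show "pres_eq ?Y (quotient_rels g) u v"
      using \<psi>_weval uv pres_class_eq_iff by metis
  next
    assume "pres_eq ?Y (quotient_rels g) u v"
    then show "weval ?Q q u = weval ?Q q v"
      using Q.pres_eq_imp_weval_eq[OF _ quotient_rels_subset_words q_carr sat uv(1)] by simp
  qed
  then show "has_presentation ?Q q ?Y (quotient_rels g)"
    unfolding has_presentation_def
    by (intro conjI ballI Q.is_group q_carr gens quotient_rels_subset_words)
qed

theorem proposition3p7:
  fixes X :: "'a topology" and k n g :: nat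
    and x0 :: "(nat \<Rightarrow> 'a) set"
    and s :: "bgen \<Rightarrow> (real \<Rightarrow> (nat \<Rightarrow> 'a) set) set"
    and G :: "(real \<Rightarrow> (nat \<Rightarrow> 'a) set) set monoid"
    and \<rho> :: "(real \<Rightarrow> (nat \<Rightarrow> 'a) set) set \<Rightarrow> (real \<Rightarrow> (nat \<Rightarrow> 'a) set) set set"
  assumes "k \<ge> 3" and "n \<ge> 3"
    and "one_boundary_surface g X"
    and "x0 \<in> topspace (mixed_config_space k n X)"
    and "G = mixed_braid_group k n X x0"
    and "has_presentation G s (braid_gens k n g) (braid_rels k n g)"
    and "\<rho> = (\<lambda>x. lower_central G 3 #>\<^bsub>G\<^esub> x)"
  shows "\<exists>q.
    has_presentation (G Mod lower_central G 3) q (quotient_gens g) (quotient_rels g) \<and>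
    q ` quotient_gens g = \<rho> ` s ` braid_gens k n g \<and>
    \<rho> ` s ` gens_S k = {q QSig} \<and>
    \<rho> ` s ` gens_TS n = {q QTSig} \<and>
    \<rho> ` s ` gens_Z n = {q QZeta} \<and>
    (\<forall>i\<in>{1..g}. q (QA i) = \<rho> (s (A i)) \<and> q (QB i) = \<rho> (s (B i)) \<and>
                q (QTA i) = \<rho> (s (TA i)) \<and> q (QTB i) = \<rho> (s (TB i)))"
proof -
  define q where "q = \<rho> \<circ> s \<circ> representative"
  note main = class_two_quotient_presentation[OF assms(1,2,6), folded assms(7), folded q_def]
  \<comment> \<open>On braid generators \<rho> after \<open>s\<close> is \<open>q\<close> after
    \<open>collapse\<close>, so the claims about images reduce to computing images under
    \<open>collapse\<close>.\<close>
  have images: "\<rho> ` s ` Y = q ` collapse ` Y" if "Y \<subseteq> braid_gens k n g" for Y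
    unfolding image_image using main(2) that by (intro image_cong) auto
  have "collapse ` braid_gens k n g = quotient_gens g"
  proof
    show "quotient_gens g \<subseteq> collapse ` braid_gens k n g"
    proof
      fix y assume "y \<in> quotient_gens g"
      then have "representative y \<in> braid_gens k n g"
        using assms(1,2) by (intro representative_in_braid_gens) auto
      then show "y \<in> collapse ` braid_gens k n g"
        by (metis collapse_representative image_eqI)
    qed
  qed (auto simp: collapse_in_quotient_gens)
  \<comment> \<open>The bounds on k and n make the three families nonempty, so that the images are
    singletons and not empty.\<close>
  moreover have "collapse ` gens_S k = {QSig}" "collapse ` gens_TS n = {QTSig}" "collapse ` gens_Z n = {QZeta}"
    using assms(1,2) by (auto simp: gens_defs image_image image_constant_conv)
  ultimately have "q ` quotient_gens g = \<rho> ` s ` braid_gens k n g" "\<rho> ` s ` gens_S k = {q QSig}"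
    "\<rho> ` s ` gens_TS n = {q QTSig}" "\<rho> ` s ` gens_Z n = {q QZeta}"
    using images[of "braid_gens k n g"] images[of "gens_S k"] images[of "gens_TS n"] images[of "gens_Z n"]
    by (simp_all add: braid_gens_def le_supI1)
  moreover have "\<forall>i\<in>{1..g}. q (QA i) = \<rho> (s (A i)) \<and> q (QB i) = \<rho> (s (B i)) \<and>
                q (QTA i) = \<rho> (s (TA i)) \<and> q (QTB i) = \<rho> (s (TB i))"
    by (simp add: q_def)
  ultimately show ?thesis
    using main(1) by blast
qed

end
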